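(* Let $E$ be a finite set, $\Omega=E^{\mathbb{Z}}$, and $S$ the left shift on $\Omega$. Let $\phi:\Omega\to\mathbb{R}$ be a continuous function with the extensibility property. Then every equilibrium state $\mu$ for $\phi$ is (1) Gibbs in the Dobrushin–Lanford–Ruelle sense, i.e. there is a Gibbsian specification $\gamma$ on $\Omega$ such that $\mu$ is a Gibbs measure for $\gamma$; (2) weak Bowen–Gibbs relative to the potential $\phi$, i.e. there exist a constant $P$ and a sequence $(C_n)_{n\ge1}$ of positive reals with $\lim_{n\to\infty}\frac1n\log C_n=0$ such that for all $n\in\mathbb{N}$ and all $\omega\in\Omega$, $$\frac{1}{C_n}\le \frac{\mu(\{\tilde\omega\in\Omega:\tilde\omega_0^{n-1}=\omega_0^{n-1}\})}{\exp\big(S_n\phi(\omega)-nP\big)}\le C_n,\qquad S_n\phi=\sum_{k=0}^{n-1}\phi\circ S^k.$$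
   Context: $E$ is finite with the discrete topology, $\Omega=E^{\mathbb{Z}}$ carries the product topology, and $S:\Omega\to\Omega$ is the left shift $(S\omega)_i=\omega_{i+1}$. For $\omega\in\Omega$ and $a\in E$, $\omega^a$ denotes the configuration equal to $a$ at site $0$ and to $\omega_k$ at every site $k\neq0$. A continuous $\phi:\Omega\to\mathbb{R}$ has the extensibility property if for all $a,\tilde a\in E$ the functions $\rho_n^{a,\tilde a}(\omega)=\sum_{i=-n}^{n}\big[\phi(S^i\omega^{a})-\phi(S^i\omega^{\tilde a})\big]$ converge uniformly in $\omega\in\Omega$ as $n\to\infty$. A shift-invariant Borel probability measure $\mu$ is an equilibrium state for $\phi$ if $h(\mu)+\int\phi\,d\mu=P(\phi)$, where $h(\mu)$ is the measure-theoretic (Kolmogorov–Sinai) entropy and $P(\phi)$ the topological pressure. For finite $\Lambda\subset\mathbb{Z}$ and $\xi,\omega\in\Omega$, $\xi_\Lambda\omega_{\Lambda^c}$ denotes the configuration equal to $\xi$ on $\Lambda$ and to $\omega$ off $\Lambda$. A specification is a family $\gamma=(\gamma_\Lambda)_{\Lambda\subset\mathbb{Z}\text{ finite}}$ where, for each $\omega$, $\gamma_\Lambda(\cdot|\omega_{\Lambda^c})$ is a probability on $E^\Lambda$ depending only on $\omega_{\Lambda^c}$; writing $\gamma_\Lambda(f|\omega)=\sum_{\xi_\Lambda\in E^\Lambda}\gamma_\Lambda(\xi_\Lambda|\omega_{\Lambda^c})f(\xi_\Lambda\omega_{\Lambda^c})$, it is required to be consistent: for finite $\Delta\subset\Lambda$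 and bounded measurable $f$, $\sum_{\xi_\Lambda}\gamma_\Lambda(\xi_\Lambda|\omega_{\Lambda^c})\gamma_\Delta(f|\xi_\Lambda\omega_{\Lambda^c})=\gamma_\Lambda(f|\omega)$. It is Gibbsian if it is non-null ($\inf_\omega\gamma_\Lambda(\omega_\Lambda|\omega_{\Lambda^c})>0$ for all finite $\Lambda$) and continuous/quasi-local ($\omega\mapsto\gamma_\Lambda(\omega_\Lambda|\omega_{\Lambda^c})$ is continuous for all finite $\Lambda$). A probability measure $\mu$ is Gibbs for $\gamma$ if $\int\gamma_\Lambda(f|\omega)\,\mu(d\omega)=\int f\,d\mu$ for all $f\in C(\Omega)$ and finite $\Lambda$. *)

theory Defs
  imports "HOL-Probability.Probability"
begin

definition Omega_top :: "(int \<Rightarrow> 'e::finite) topology" where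
  "Omega_top = product_topology (\<lambda>_. discrete_topology UNIV) UNIV"

definition Omega_borel :: "(int \<Rightarrow> 'e::finite) measure" where
  "Omega_borel = sigma UNIV {U. openin Omega_top U}"

definition shift :: "(int \<Rightarrow> 'e) \<Rightarrow> (int \<Rightarrow> 'e)" where
  "shift w = (\<lambda>i. w (i + 1))"

definition shiftp :: "int \<Rightarrow> (int \<Rightarrow> 'e) \<Rightarrow> (int \<Rightarrow> 'e)" where
  "shiftp k w = (\<lambda>j. w (j + k))"

definition birkhoff :: "nat \<Rightarrow> ((int \<Rightarrow> 'e) \<Rightarrow> real) \<Rightarrow> (int \<Rightarrow> 'e) \<Rightarrow> real" where
  "birkhoff n phi w = (\<Sum>k<n. phi ((shift ^^ k) w))"

definition cyl :: "nat \<Rightarrow> (int \<Rightarrow> 'e) \<Rightarrow> (int \<Rightarrow> 'e) set" where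
  "cyl n w = {w'. \<forall>i<n. w' (int i) = w (int i)}"

definition rho :: "((int \<Rightarrow> 'e) \<Rightarrow> real) \<Rightarrow> 'e \<Rightarrow> 'e \<Rightarrow> nat \<Rightarrow> (int \<Rightarrow> 'e) \<Rightarrow> real" where
  "rho phi a a' n w = (\<Sum>i\<in>{- int n..int n}. phi (shiftp i (w(0 := a))) - phi (shiftp i (w(0 := a'))))"

definition extensible :: "((int \<Rightarrow> 'e::finite) \<Rightarrow> real) \<Rightarrow> bool" where
  "extensible phi \<longleftrightarrow> (\<forall>a a'. uniformly_convergent_on UNIV (rho phi a a'))"

definition invariant_prob :: "(int \<Rightarrow> 'e::finite) measure \<Rightarrow> bool" where
  "invariant_prob mu \<longleftrightarrow> prob_space mu \<and> space mu = UNIV \<and> sets mu = sets Omega_borel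
     \<and> shift \<in> measurable mu mu \<and> distr mu mu shift = mu"

text \<open>Kolmogorov--Sinai entropy. A finite measurable partition is represented by a
  measurable map xi into nat with finite range (its atoms are the fibres).
  H_mu(f) is the Shannon entropy of the partition into fibres of f (0 ln 0 = 0 automatically).\<close>
definition part_entropy :: "'a measure \<Rightarrow> ('a \<Rightarrow> 'b) \<Rightarrow> real" where
  "part_entropy mu f = - (\<Sum>y\<in>f ` space mu.
       measure mu (f -` {y} \<inter> space mu) * ln (measure mu (f -` {y} \<inter> space mu)))"

definition ks_entropy_part :: "(int \<Rightarrow> 'e) measure \<Rightarrow> ((int \<Rightarrow> 'e) \<Rightarrow> nat) \<Rightarrow> real" where
  "ks_entropy_part mu xi =
     lim (\<lambda>n. part_entropy mu (\<lambda>w. map (\<lambda>k. xi ((shift ^^ k) w)) [0..<n]) / real n)"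

definition ks_entropy :: "(int \<Rightarrow> 'e) measure \<Rightarrow> real" where
  "ks_entropy mu = (SUP xi \<in> {xi. xi \<in> measurable mu (count_space UNIV) \<and> finite (range xi)}.
                      ks_entropy_part mu xi)"

definition word_cyl :: "'e list \<Rightarrow> (int \<Rightarrow> 'e) set" where
  "word_cyl ws = {w. \<forall>i<length ws. w (int i) = ws ! i}"

definition top_pressure :: "((int \<Rightarrow> 'e::finite) \<Rightarrow> real) \<Rightarrow> real" where
  "top_pressure phi = lim (\<lambda>n. ln (\<Sum>ws\<in>{ws :: 'e list. length ws = n}.
        exp (SUP w \<in> word_cyl ws. birkhoff n phi w)) / real n)"

definition equilibrium_state :: "((int \<Rightarrow> 'e::finite) \<Rightarrow> real) \<Rightarrow> (int \<Rightarrow> 'e) measure \<Rightarrow> bool" where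
  "equilibrium_state phi mu \<longleftrightarrow> invariant_prob mu \<and>
     ks_entropy mu + integral\<^sup>L mu phi = top_pressure phi"

text \<open>Specification kernels. gamma L eta w is gamma_L(eta_L | w_{L^c}); it must depend only on
  eta restricted to L and w restricted to the complement of L.  The configurations
  xi_L w_{L^c} are the elements of conf L w.\<close>
definition conf :: "int set \<Rightarrow> (int \<Rightarrow> 'e) \<Rightarrow> (int \<Rightarrow> 'e) set" where
  "conf L w = {eta. \<forall>i. i \<notin> L \<longrightarrow> eta i = w i}"

definition spec_apply ::
  "(int set \<Rightarrow> (int \<Rightarrow> 'e) \<Rightarrow> (int \<Rightarrow> 'e) \<Rightarrow> real) \<Rightarrow> int set \<Rightarrow> ((int \<Rightarrow> 'e) \<Rightarrow> real) \<Rightarrow> (int \<Rightarrow> 'e) \<Rightarrow> real" where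
  "spec_apply gamma L f w = (\<Sum>eta\<in>conf L w. gamma L eta w * f eta)"

definition is_specification ::
  "(int set \<Rightarrow> (int \<Rightarrow> 'e::finite) \<Rightarrow> (int \<Rightarrow> 'e) \<Rightarrow> real) \<Rightarrow> bool" where
  "is_specification gamma \<longleftrightarrow>
     (\<forall>L. finite L \<longrightarrow>
        (\<forall>eta w. gamma L eta w \<ge> 0) \<and>
        (\<forall>eta eta' w w'. (\<forall>i\<in>L. eta i = eta' i) \<longrightarrow> (\<forall>i. i \<notin> L \<longrightarrow> w i = w' i)
             \<longrightarrow> gamma L eta w = gamma L eta' w') \<and>
        (\<forall>w. (\<Sum>eta\<in>conf L w. gamma L eta w) = 1)) \<and>
     (\<forall>L D. finite L \<longrightarrow> D \<subseteq> L \<longrightarrow>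
        (\<forall>f. f \<in> borel_measurable Omega_borel \<longrightarrow> bounded (range f) \<longrightarrow>
           (\<forall>w. (\<Sum>eta\<in>conf L w. gamma L eta w * spec_apply gamma D f eta) = spec_apply gamma L f w)))"

definition gibbsian_specification ::
  "(int set \<Rightarrow> (int \<Rightarrow> 'e::finite) \<Rightarrow> (int \<Rightarrow> 'e) \<Rightarrow> real) \<Rightarrow> bool" where
  "gibbsian_specification gamma \<longleftrightarrow> is_specification gamma \<and>
     (\<forall>L. finite L \<longrightarrow> (INF w. gamma L w w) > 0) \<and>
     (\<forall>L. finite L \<longrightarrow> continuous_map Omega_top euclideanreal (\<lambda>w. gamma L w w))"

definition gibbs_measure ::
  "(int set \<Rightarrow> (int \<Rightarrow> 'e::finite) \<Rightarrow> (int \<Rightarrow> 'e) \<Rightarrow> real) \<Rightarrow> (int \<Rightarrow> 'e) measure \<Rightarrow> bool" where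
  "gibbs_measure gamma mu \<longleftrightarrow>
     (\<forall>f L. continuous_map Omega_top euclideanreal f \<longrightarrow> finite L \<longrightarrow>
        integral\<^sup>L mu (spec_apply gamma L f) = integral\<^sup>L mu f)"

definition weak_bowen_gibbs :: "((int \<Rightarrow> 'e::finite) \<Rightarrow> real) \<Rightarrow> (int \<Rightarrow> 'e) measure \<Rightarrow> bool" where
  "weak_bowen_gibbs phi mu \<longleftrightarrow>
     (\<exists>P::real. \<exists>C::nat \<Rightarrow> real. (\<forall>n\<ge>1. C n > 0) \<and>
        ((\<lambda>n. ln (C n) / real n) \<longlonglongrightarrow> 0) \<and>
        (\<forall>n\<ge>1. \<forall>w. 1 / C n \<le> measure mu (cyl n w) / exp (birkhoff n phi w - real n * P)
                 \<and> measure mu (cyl n w) / exp (birkhoff n phi w - real n * P) \<le> C n))"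

end

theory Submission
  imports Defs
begin

text \<open>
  Extensibility makes the relative energy R z y, the sum over all i of
  phi(S^i z) - phi(S^i y), converge for configurations differing at finitely many sites, and the
  kernels proportional to exp(R z y) form a Gibbsian specification. Interpolating between z and y one
  site at a time shows that on [0,n) this energy is S_n phi(z) - S_n phi(y) up to o(n), so the kernel
  of [0,n) is exp(S_n phi - n P) up to a factor exp(o(n)).

  For an equilibrium state mu, P minus the mean of phi is at most H_n/n, with H_n the entropy of
  words of length n. Bounding H_n by the cross entropy against the kernel of [0,n) tilted by exp F
  gives: the mean of F is at most ln of the kernel average of exp F, plus o(n). Taking for F the sum
  of t g over n/m well separated translates of a local g with vanishing conditional expectation, that
  average factorises and is at most exp(O(t^2) n/m); letting n tend to infinity and then t to 0
  yields mu(g) = 0, which is the DLR equation. The weak Bowen-Gibbs property follows by integrating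
  the kernel bound.
\<close>

section \<open>Subadditive sequences\<close>

text \<open>The obstacle is that extensibility gives convergence of the one-site energies without a
  rate, so every comparison with S_n phi holds up to o(n), and an error of that size says nothing
  about a single window. The remedy is to test on a number of windows proportional to n. For K
  windows and F equal to t times the sum of K translates of g, the mean of F is K t mu(g) by
  invariance, while the logarithm of the tilted average is at most K (t e' + t^2 B^2), where e'
  bounds the conditional expectation of g and B bounds g. Both are linear in K: dividing by K
  removes the o(n) term at fixed t, and dividing by t leaves t B^2, which vanishes with t. So that
  such limits can be combined, each o(n) error is carried in the form: for every e > 0 there is a C,
  independent of n and of the configurations, such that the error is at most e n + C.\<close>

lemma subadditive_affine_bound:
  fixes a :: "nat \<Rightarrow> real"
  assumes sub: "\<And>m n. a (m + n) \<le> a m + a n" and p: "p > 0"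
  shows "\<exists>B. \<forall>n. a n \<le> real n * (a p / real p) + B"
proof -
  have mult: "a (q * p + r) \<le> real q * a p + a r" for q r
  proof (induction q)
    case (Suc q)
    have "a (Suc q * p + r) \<le> a p + a (q * p + r)"
      using sub[of p "q * p + r"] by (simp add: add.assoc)
    with Suc show ?case by (simp add: algebra_simps)
  qed simp
  \<comment> \<open>Writing n = q p + r, the first term pays for replacing q by n / p, and the sum
    dominates \<open>a r\<close> for every possible remainder.\<close>
  define B where "B = \<bar>a p\<bar> + (\<Sum>r<p. \<bar>a r\<bar>)"
  have "a n \<le> real n * (a p / real p) + B" for n
  proof -
    define q r where "q = n div p" and "r = n mod p"
    have n: "n = q * p + r" and r: "r < p" using p by (auto simp: q_def r_def)
    have "a n \<le> real q * a p + a r" using mult n by metis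
    also have "real q * a p = real n * (a p / real p) - (real r / real p) * a p"
      using p by (simp add: n field_simps)
    also have "- ((real r / real p) * a p) \<le> \<bar>a p\<bar>"
    proof -
      have "- ((real r / real p) * a p) \<le> (real r / real p) * \<bar>a p\<bar>"
        by (metis abs_ge_minus_self abs_mult abs_of_nonneg divide_nonneg_nonneg of_nat_0_le_iff)
      also have "\<dots> \<le> 1 * \<bar>a p\<bar>" using r by (intro mult_right_mono) auto
      finally show ?thesis by simp
    qed
    moreover have "a r \<le> (\<Sum>r<p. \<bar>a r\<bar>)"
      using member_le_sum[of r "{..<p}" "\<lambda>r. \<bar>a r\<bar>"] r by auto
    ultimately show ?thesis by (simp add: B_def)
  qed
  then show ?thesis by blast
qed

text \<open>The limit is the infimum of \<open>a n / n\<close> over n >= 1, finite by the linear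
  lower bound. An index q that nearly attains it controls all large n through the affine
  bound.\<close>

lemma fekete:
  fixes a :: "nat \<Rightarrow> real"
  assumes sub: "\<And>m n. a (m + n) \<le> a m + a n" and lb: "\<And>n. c * real n \<le> a n"
  shows "convergent (\<lambda>n. a n / real n)"
proof -
  define l where "l = (INF n\<in>{1..}. a n / real n)"
  have bdd: "bdd_below ((\<lambda>n. a n / real n) ` {1..})"
    by (rule bdd_belowI2[of _ c]) (use lb in \<open>auto simp: field_simps\<close>)
  have l_le: "l \<le> a n / real n" if "n > 0" for n
    unfolding l_def by (rule cINF_lower[OF bdd]) (use that in auto)
  have lim: "(\<lambda>n. a n / real n) \<longlonglongrightarrow> l"
  proof (rule LIMSEQ_I)
    fix e :: real assume e: "e > 0"
    have "\<exists>q\<in>{1..}. a q / real q < l + e/2"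
      using cINF_less_iff[OF _ bdd, of "l + e/2"] e by (auto simp: l_def)
    then obtain q where q: "q > 0" "a q / real q < l + e/2" by (auto simp: Suc_le_eq)
    obtain B where B: "\<And>n. a n \<le> real n * (a q / real q) + B"
      using subadditive_affine_bound[of a q] sub q by blast
    obtain N where N: "real N > 2 * \<bar>B\<bar> / e" using reals_Archimedean2 by blast
    have "norm (a n / real n - l) < e" if n: "n \<ge> Suc N" for n
    proof -
      have n0: "real n > 0" using n by simp
      have "2 * \<bar>B\<bar> / e < real n" using N n by linarith
      then have "\<bar>B\<bar> / real n < e/2" using e n0 by (simp add: field_simps)
      moreover have "B / real n \<le> \<bar>B\<bar> / real n" using n0 by (simp add: divide_right_mono)
      moreover have "a n / real n \<le> a q / real q + B / real n"
        using B[of n] n0 by (simp add: field_simps)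
      ultimately have "a n / real n < l + e" using q by linarith
      moreover have "l \<le> a n / real n" using l_le n by auto
      ultimately show ?thesis by auto
    qed
    then show "\<exists>no. \<forall>n\<ge>no. norm (a n / real n - l) < e" by blast
  qed
  show ?thesis using lim by (rule convergentI)
qed

section \<open>Entropy of finite partitions\<close>

lemma (in prob_space) integral_finite_valued:
  fixes f :: "'a \<Rightarrow> 'b" and G :: "'b \<Rightarrow> real"
  assumes f: "f \<in> measurable M (count_space UNIV)" and fin: "finite (f ` space M)"
  shows "integrable M (\<lambda>w. G (f w))"
    and "integral\<^sup>L M (\<lambda>w. G (f w)) = (\<Sum>y\<in>f ` space M. measure M (f -` {y} \<inter> space M) * G y)"
proof -
  have meas: "f -` {y} \<inter> space M \<in> sets M" for y using f by (auto simp: measurable_def)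
  have eq: "G (f w) = (\<Sum>y\<in>f ` space M. indicator (f -` {y} \<inter> space M) w * G y)" if "w \<in> space M" for w
    using that fin by (subst sum.remove[of _ "f w"]) (auto simp: indicator_def intro!: sum.neutral)
  have int: "integrable M (\<lambda>w. indicator (f -` {y} \<inter> space M) w * G y)" for y
    using meas by (auto simp: emeasure_eq_measure)
  show "integrable M (\<lambda>w. G (f w))"
    by (subst Bochner_Integration.integrable_cong[OF refl eq]) (auto intro!: Bochner_Integration.integrable_sum int)
  have "integral\<^sup>L M (\<lambda>w. G (f w)) = integral\<^sup>L M (\<lambda>w. \<Sum>y\<in>f ` space M. indicator (f -` {y} \<inter> space M) w * G y)"
    by (rule Bochner_Integration.integral_cong[OF refl eq])
  also have "\<dots> = (\<Sum>y\<in>f ` space M. measure M (f -` {y} \<inter> space M) * G y)"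
    by (subst Bochner_Integration.integral_sum[OF int])
       (auto simp: Int_commute intro!: sum.cong)
  finally show "integral\<^sup>L M (\<lambda>w. G (f w)) = (\<Sum>y\<in>f ` space M. measure M (f -` {y} \<inter> space M) * G y)" .
qed

lemma (in prob_space) sum_fibres:
  assumes f: "f \<in> measurable M (count_space UNIV)" and fin: "finite (f ` space M)"
  shows "(\<Sum>y\<in>f ` space M. measure M (f -` {y} \<inter> space M)) = 1"
  using integral_finite_valued(2)[OF f fin, of "\<lambda>_. 1"] by (simp add: prob_space)

lemma (in prob_space) part_entropy_eq_integral:
  assumes f: "f \<in> measurable M (count_space UNIV)" and fin: "finite (f ` space M)"
  shows "part_entropy M f = - integral\<^sup>L M (\<lambda>w. ln (measure M (f -` {f w} \<inter> space M)))"
  unfolding part_entropy_def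
  using integral_finite_valued(2)[OF f fin, of "\<lambda>y. ln (measure M (f -` {y} \<inter> space M))"] by simp

text \<open>Gibbs' inequality, from ln x <= x - 1 at the quotient of \<open>q y\<close> by the
  measure of the fibre. Total mass below 1 is allowed, so q may come from a distribution on a larger
  set.\<close>

lemma (in prob_space) part_entropy_le_cross_entropy:
  fixes f :: "'a \<Rightarrow> 'b" and q :: "'b \<Rightarrow> real"
  assumes f: "f \<in> measurable M (count_space UNIV)" and fin: "finite (f ` space M)"
    and q0: "\<And>y. 0 \<le> q y"
    and q: "\<And>y. y \<in> f ` space M \<Longrightarrow> measure M (f -` {y} \<inter> space M) > 0 \<Longrightarrow> q y > 0"
    and sum: "(\<Sum>y\<in>f ` space M. q y) \<le> 1"
  shows "part_entropy M f \<le> - integral\<^sup>L M (\<lambda>w. ln (q (f w)))"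
proof -
  let ?p = "\<lambda>y. measure M (f -` {y} \<inter> space M)"
  have "?p y * ln (q y) - ?p y * ln (?p y) \<le> q y - ?p y" if y: "y \<in> f ` space M" for y
  proof (cases "?p y > 0")
    case True
    then have "ln (q y) - ln (?p y) = ln (q y / ?p y)" using q[OF y] by (simp add: ln_div)
    also have "\<dots> \<le> q y / ?p y - 1" using True q[OF y] by (intro ln_le_minus_one) auto
    finally have "?p y * (ln (q y) - ln (?p y)) \<le> ?p y * (q y / ?p y - 1)"
      using True by (intro mult_left_mono) auto
    then show ?thesis using True by (simp add: algebra_simps)
  next
    case False
    then have "?p y = 0" using measure_nonneg[of M "f -` {y} \<inter> space M"] by linarith
    then show ?thesis using q0 by simp
  qed
  then have "(\<Sum>y\<in>f ` space M. ?p y * ln (q y) - ?p y * ln (?p y)) \<le> (\<Sum>y\<in>f ` space M. q y - ?p y)"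
    by (rule sum_mono)
  also have "\<dots> \<le> 0" using sum sum_fibres[OF f fin] by (simp add: sum_subtractf)
  finally show ?thesis
    using integral_finite_valued(2)[OF f fin, of "\<lambda>y. ln (q y)"]
    by (simp add: part_entropy_def sum_subtractf)
qed

lemma (in prob_space) part_entropy_nonneg: "0 \<le> part_entropy M f"
proof -
  have "(\<Sum>y\<in>f ` space M. prob (f -` {y} \<inter> space M) * ln (prob (f -` {y} \<inter> space M))) \<le> 0"
  proof (rule sum_nonpos)
    fix y
    have "prob (f -` {y} \<inter> space M) \<le> 1" by simp
    then have "ln (prob (f -` {y} \<inter> space M)) \<le> 0"
      by (cases "prob (f -` {y} \<inter> space M) = 0") (auto simp: less_le)
    then show "prob (f -` {y} \<inter> space M) * ln (prob (f -` {y} \<inter> space M)) \<le> 0"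
      by (simp add: mult_nonneg_nonpos)
  qed
  then show ?thesis by (simp add: part_entropy_def)
qed

text \<open>Passing to \<open>h (g w)\<close> enlarges the fibre through each point, hence lowers
  minus the logarithm of its measure.\<close>

lemma (in prob_space) part_entropy_comp_le:
  assumes g: "g \<in> measurable M (count_space UNIV)" and fin: "finite (g ` space M)"
  shows "part_entropy M (\<lambda>w. h (g w)) \<le> part_entropy M g"
proof -
  let ?f = "\<lambda>w. h (g w)"
  let ?p = "\<lambda>f y. prob (f -` {y} \<inter> space M)"
  have f: "?f \<in> measurable M (count_space UNIV)" using g by (rule measurable_compose) simp
  have ff: "finite (?f ` space M)" using finite_imageI[OF fin, of h] by (simp add: image_image)
  have meas: "k -` {y} \<inter> space M \<in> sets M" if "k \<in> measurable M (count_space UNIV)" for k :: "'a \<Rightarrow> 'd" and y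
    using that by (auto simp: measurable_def)
  have "part_entropy M ?f = - (\<Sum>y\<in>g ` space M. ?p g y * ln (?p ?f (h y)))"
    using part_entropy_eq_integral[OF f ff] integral_finite_valued(2)[OF g fin, of "\<lambda>y. ln (?p ?f (h y))"]
    by simp
  also have "\<dots> \<le> - (\<Sum>y\<in>g ` space M. ?p g y * ln (?p g y))"
  proof -
    have "?p g y * ln (?p g y) \<le> ?p g y * ln (?p ?f (h y))" for y
    proof (cases "?p g y > 0")
      case True
      have "?p g y \<le> ?p ?f (h y)" by (rule finite_measure_mono) (auto intro: meas[OF f])
      with True show ?thesis by (intro mult_left_mono) auto
    next
      case False
      then have "?p g y = 0" using measure_nonneg[of M "g -` {y} \<inter> space M"] by linarith
      then show ?thesis by simp
    qed
    then show ?thesis by (simp add: sum_mono)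
  qed
  finally show ?thesis by (simp add: part_entropy_def)
qed

text \<open>Cross entropy of the joint distribution against the product of its marginals; the
  difference of the two sides is the mutual information.\<close>

lemma (in prob_space) part_entropy_pair_le:
  assumes f: "f \<in> measurable M (count_space UNIV)" and ff: "finite (f ` space M)"
    and g: "g \<in> measurable M (count_space UNIV)" and fg: "finite (g ` space M)"
    and fgm: "(\<lambda>w. (f w, g w)) \<in> measurable M (count_space UNIV)"
  shows "part_entropy M (\<lambda>w. (f w, g w)) \<le> part_entropy M f + part_entropy M g"
proof -
  let ?p = "\<lambda>f y. prob (f -` {y} \<inter> space M)"
  let ?h = "\<lambda>w. (f w, g w)"
  have meas: "k -` {y} \<inter> space M \<in> sets M" if "k \<in> measurable M (count_space UNIV)" for k :: "'a \<Rightarrow> 'd" and y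
    using that by (auto simp: measurable_def)
  have sub: "?h ` space M \<subseteq> f ` space M \<times> g ` space M" by auto
  have fin: "finite (?h ` space M)" using sub ff fg by (meson finite_SigmaI finite_subset)
  define q where "q = (\<lambda>(a, b). ?p f a * ?p g b)"
  have pos: "?p f a > 0 \<and> ?p g b > 0" if "?p ?h (a, b) > 0" for a b
  proof -
    have "?p ?h (a, b) \<le> ?p f a" "?p ?h (a, b) \<le> ?p g b"
      by (rule finite_measure_mono; auto intro: meas[OF f] meas[OF g])+
    with that show ?thesis by linarith
  qed
  have "(\<Sum>y\<in>?h ` space M. q y) \<le> (\<Sum>y\<in>f ` space M \<times> g ` space M. q y)"
    by (rule sum_mono2) (use sub ff fg in \<open>auto simp: q_def\<close>)
  also have "\<dots> = (\<Sum>a\<in>f ` space M. \<Sum>b\<in>g ` space M. ?p f a * ?p g b)"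
    by (simp add: sum.cartesian_product q_def)
  also have "\<dots> = 1"
    by (simp add: sum_distrib_left[symmetric] sum_fibres[OF g fg] sum_fibres[OF f ff])
  finally have sum: "(\<Sum>y\<in>?h ` space M. q y) \<le> 1" .
  have "part_entropy M ?h \<le> - integral\<^sup>L M (\<lambda>w. ln (q (?h w)))"
    by (rule part_entropy_le_cross_entropy[OF fgm fin _ _ sum]) (use pos in \<open>auto simp: q_def\<close>)
  also have "integral\<^sup>L M (\<lambda>w. ln (q (?h w))) = (\<Sum>y\<in>?h ` space M. ?p ?h y * ln (q y))"
    by (rule integral_finite_valued(2)[OF fgm fin])
  also have "\<dots> = (\<Sum>y\<in>?h ` space M. ?p ?h y * (ln (?p f (fst y)) + ln (?p g (snd y))))"
  proof (rule sum.cong[OF refl], goal_cases)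
    case (1 y)
    obtain a b where y: "y = (a, b)" by (cases y)
    show ?case
    proof (cases "?p ?h (a, b) > 0")
      case True
      then show ?thesis using pos[OF True] by (simp add: y q_def ln_mult)
    next
      case False
      then have "?p ?h (a, b) = 0" using measure_nonneg[of M "?h -` {(a,b)} \<inter> space M"] by linarith
      then show ?thesis by (simp add: y)
    qed
  qed
  also have "\<dots> = integral\<^sup>L M (\<lambda>w. ln (?p f (f w)) + ln (?p g (g w)))"
    using integral_finite_valued(2)[OF fgm fin, of "\<lambda>y. ln (?p f (fst y)) + ln (?p g (snd y))"] by simp
  also have "\<dots> = - part_entropy M f - part_entropy M g"
    using integral_finite_valued(1)[OF f ff, of "\<lambda>y. ln (?p f y)"]
      integral_finite_valued(1)[OF g fg, of "\<lambda>y. ln (?p g y)"]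
    by (simp add: part_entropy_eq_integral[OF f ff] part_entropy_eq_integral[OF g fg])
  finally show ?thesis by simp
qed

lemma (in prob_space) part_entropy_distr:
  assumes T: "T \<in> measurable M M" and inv: "distr M M T = M"
    and f: "f \<in> measurable M (count_space UNIV)" and fin: "finite (f ` space M)"
  shows "part_entropy M (\<lambda>w. f (T w)) = part_entropy M f"
proof -
  let ?p = "\<lambda>f y. prob (f -` {y} \<inter> space M)"
  have fT: "(\<lambda>w. f (T w)) \<in> measurable M (count_space UNIV)" using T f by (rule measurable_compose)
  have sub: "(\<lambda>w. f (T w)) ` space M \<subseteq> f ` space M" using T by (auto simp: measurable_def)
  have p: "?p (\<lambda>w. f (T w)) y = ?p f y" for y
  proof -
    have m: "f -` {y} \<inter> space M \<in> sets M" using f by (auto simp: measurable_def)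
    have "?p f y = measure (distr M M T) (f -` {y} \<inter> space M)" by (simp add: inv)
    also have "\<dots> = prob (T -` (f -` {y} \<inter> space M) \<inter> space M)" by (rule measure_distr[OF T m])
    also have "T -` (f -` {y} \<inter> space M) \<inter> space M = (\<lambda>w. f (T w)) -` {y} \<inter> space M"
      using T by (auto simp: measurable_def)
    finally show ?thesis by simp
  qed
  have "(\<Sum>y\<in>(\<lambda>w. f (T w)) ` space M. ?p f y * ln (?p f y)) = (\<Sum>y\<in>f ` space M. ?p f y * ln (?p f y))"
  proof (rule sum.mono_neutral_left[OF fin sub], rule ballI)
    \<comment> \<open>T need not be onto, so f may take values that its composition with T misses.
      By invariance these have measure zero and contribute nothing.\<close>
    fix y assume "y \<in> f ` space M - (\<lambda>w. f (T w)) ` space M"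
    then have "(\<lambda>w. f (T w)) -` {y} \<inter> space M = {}" by (auto simp: image_iff)
    then have "?p f y = 0" using p[of y] by (metis measure_empty)
    then show "?p f y * ln (?p f y) = 0" by simp
  qed
  then show ?thesis by (simp add: part_entropy_def p)
qed

section \<open>Uniform continuity on the configuration space\<close>

definition glue :: "int set \<Rightarrow> (int \<Rightarrow> 'e) \<Rightarrow> (int \<Rightarrow> 'e) \<Rightarrow> (int \<Rightarrow> 'e)" where
  "glue L x w = (\<lambda>i. if i \<in> L then x i else w i)"

definition agree :: "nat \<Rightarrow> (int \<Rightarrow> 'e) \<Rightarrow> (int \<Rightarrow> 'e) \<Rightarrow> bool" where
  "agree N w w' \<longleftrightarrow> (\<forall>i. \<bar>i\<bar> \<le> int N \<longrightarrow> w i = w' i)"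

text \<open>Uniform continuity for the product uniformity. On the compact space it coincides with
  continuity, and it yields a window radius that serves all configurations at once.\<close>

definition ucont :: "((int \<Rightarrow> 'e) \<Rightarrow> real) \<Rightarrow> bool" where
  "ucont f \<longleftrightarrow> (\<forall>e>0. \<exists>N. \<forall>w w'. agree N w w' \<longrightarrow> \<bar>f w - f w'\<bar> \<le> e)"

lemma agree_mono: "agree N w w' \<Longrightarrow> M \<le> N \<Longrightarrow> agree M w w'"
  by (auto simp: agree_def)

lemma agree_refl [simp]: "agree N w w"
  by (simp add: agree_def)

lemma agree_sym: "agree N w w' \<longleftrightarrow> agree N w' w"
  by (auto simp: agree_def)

lemma topspace_Omega_top [simp]: "topspace Omega_top = UNIV"
  by (simp add: Omega_top_def)

lemma compact_space_Omega_top: "compact_space Omega_top"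
  by (simp add: Omega_top_def compact_space_product_topology compact_space_discrete_topology)

lemma openin_Omega_top_iff:
  "openin Omega_top U \<longleftrightarrow> (\<forall>w\<in>U. \<exists>N. \<forall>w'. agree N w w' \<longrightarrow> w' \<in> U)"
proof safe
  fix w assume U: "openin Omega_top U" and w: "w \<in> U"
  obtain V where V: "finite {i. V i \<noteq> UNIV}" "w \<in> PiE UNIV V" "PiE UNIV V \<subseteq> U"
    using U w unfolding Omega_top_def openin_product_topology_alt by fastforce
  \<comment> \<open>The sum of the absolute values dominates each of the finitely many constrained
    sites.\<close>
  define N where "N = (\<Sum>i\<in>{i. V i \<noteq> UNIV}. nat \<bar>i\<bar>)"
  have N: "\<bar>i\<bar> \<le> int N" if "V i \<noteq> UNIV" for i
  proof -
    have "nat \<bar>i\<bar> \<le> N"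
      unfolding N_def by (rule member_le_sum) (use V that in auto)
    then show ?thesis by linarith
  qed
  have "w' \<in> U" if "agree N w w'" for w'
  proof -
    have "w' i \<in> V i" for i
      using V(2) N[of i] that by (cases "V i = UNIV") (auto simp: agree_def PiE_iff, metis)
    then show ?thesis using V(3) by (auto simp: PiE_iff)
  qed
  then show "\<exists>N. \<forall>w'. agree N w w' \<longrightarrow> w' \<in> U" by blast
next
  assume *: "\<forall>w\<in>U. \<exists>N. \<forall>w'. agree N w w' \<longrightarrow> w' \<in> U"
  show "openin Omega_top U"
    unfolding Omega_top_def openin_product_topology_alt
  proof safe
    fix w assume "w \<in> U"
    then obtain N where N: "\<And>w'. agree N w w' \<Longrightarrow> w' \<in> U" using * by blast
    define V where "V = (\<lambda>i::int. if \<bar>i\<bar> \<le> int N then {w i} else UNIV)"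
    have "finite {i \<in> UNIV. V i \<noteq> topspace (discrete_topology UNIV)}"
      by (rule finite_subset[of _ "{- int N..int N}"]) (auto simp: V_def split: if_splits)
    moreover have "PiE UNIV V \<subseteq> U"
      using N by (fastforce simp: PiE_iff V_def agree_def split: if_splits)
    moreover have "w \<in> PiE UNIV V" by (auto simp: V_def)
    ultimately show "\<exists>V. finite {i \<in> UNIV. V i \<noteq> topspace (discrete_topology UNIV)} \<and>
         (\<forall>i\<in>UNIV. openin (discrete_topology UNIV) (V i)) \<and> w \<in> PiE UNIV V \<and> PiE UNIV V \<subseteq> U"
      by (intro exI[of _ V]) auto
  qed
qed

lemma openin_agree: "openin Omega_top {w'. agree N w w'}"
  unfolding openin_Omega_top_iff by (auto simp: agree_def intro!: exI[of _ N])

lemma continuous_map_iff_ucont: "continuous_map Omega_top euclideanreal f \<longleftrightarrow> ucont f"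
proof
  assume f: "continuous_map Omega_top euclideanreal f"
  show "ucont f" unfolding ucont_def
  proof (intro allI impI)
    fix e :: real assume e: "e > 0"
    have "\<exists>N. \<forall>w'. agree N w w' \<longrightarrow> \<bar>f w - f w'\<bar> < e/2" for w
    proof -
      have "openin Omega_top {x \<in> topspace Omega_top. f x \<in> ball (f w) (e/2)}"
        using f by (intro openin_continuous_map_preimage[of _ euclideanreal]) auto
      then show ?thesis using e by (auto simp: openin_Omega_top_iff dist_real_def)
    qed
    then obtain N where N: "\<And>w w'. agree (N w) w w' \<Longrightarrow> \<bar>f w - f w'\<bar> < e/2" by metis
    define \<U> where "\<U> = (\<lambda>w. {w'. agree (N w) w w'}) ` UNIV"
    have "\<Union>\<U> = UNIV" by (auto simp: \<U>_def)
    then obtain \<F> where F: "finite \<F>" "\<F> \<subseteq> \<U>" "UNIV \<subseteq> \<Union>\<F>"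
      using compact_space_Omega_top unfolding compact_space_alt
      by (smt (verit, ccfv_SIG) \<U>_def image_iff openin_agree top.extremum topspace_Omega_top)
    then obtain W where W: "finite W" "\<F> = (\<lambda>w. {w'. agree (N w) w w'}) ` W"
      unfolding \<U>_def by (meson finite_subset_image)
    \<comment> \<open>M dominates every radius of the finite subcover, so configurations agreeing on
      this window lie in a common member of the cover and both values are within e/2 of the value at
      its centre.\<close>
    define M where "M = (\<Sum>w\<in>W. N w)"
    have "\<bar>f v - f v'\<bar> \<le> e" if a: "agree M v v'" for v v'
    proof -
      obtain w where w: "w \<in> W" "agree (N w) w v" using F(3) W by auto
      have "N w \<le> M" unfolding M_def using W(1) w(1) by (intro member_le_sum) auto
      then have "agree (N w) v v'" using a agree_mono by blast
      then have "agree (N w) w v'" using w(2) by (auto simp: agree_def)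
      then show ?thesis using N[OF w(2)] N[of w v'] by linarith
    qed
    then show "\<exists>N. \<forall>w w'. agree N w w' \<longrightarrow> \<bar>f w - f w'\<bar> \<le> e" by blast
  qed
next
  assume f: "ucont f"
  show "continuous_map Omega_top euclideanreal f"
    unfolding continuous_map_def
  proof (intro conjI allI impI)
    fix U :: "real set" assume "openin euclideanreal U"
    then have U: "open U" by simp
    have "openin Omega_top {x. f x \<in> U}" unfolding openin_Omega_top_iff
    proof safe
      fix w assume "f w \<in> U"
      then obtain e where e: "e > 0" "\<And>y. dist y (f w) < e \<Longrightarrow> y \<in> U" using U by (metis open_dist)
      obtain N where N: "\<And>w w'. agree N w w' \<Longrightarrow> \<bar>f w - f w'\<bar> \<le> e/2"
        using f e(1) unfolding ucont_def by (meson half_gt_zero)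
      have "f w' \<in> U" if "agree N w w'" for w'
        using N[OF that] e(1) by (intro e(2)) (unfold dist_real_def, linarith)
      then show "\<exists>N. \<forall>w'. agree N w w' \<longrightarrow> w' \<in> {x. f x \<in> U}" by auto
    qed
    then show "openin Omega_top {x \<in> topspace Omega_top. f x \<in> U}" by simp
  qed auto
qed

section \<open>Calculus of uniformly continuous functions on the configuration space\<close>

lemma ucontD:
  assumes "ucont f" "e > 0"
  obtains N where "\<And>w w'. agree N w w' \<Longrightarrow> \<bar>f w - f w'\<bar> \<le> e"
  using assms unfolding ucont_def by blast

lemma ucont_attains_inf:
  assumes "ucont (f :: (int \<Rightarrow> 'e::finite) \<Rightarrow> real)"
  obtains w where "\<And>w'. f w \<le> f w'"
proof -
  have "compactin euclideanreal (f ` UNIV)"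
    using assms compact_space_Omega_top
    by (metis compact_space_def continuous_map_iff_ucont image_compactin topspace_Omega_top)
  then have "compact (range f)" by simp
  then obtain y where "y \<in> range f" "\<forall>z\<in>range f. y \<le> z"
    using compact_attains_inf[of "range f"] by auto
  then show thesis using that by auto
qed

lemma ucont_minus: "ucont f \<Longrightarrow> ucont (\<lambda>w. - f w)"
  unfolding ucont_def by (metis abs_minus_commute minus_diff_minus abs_minus_cancel)

lemma ucont_bounded:
  assumes "ucont (f :: (int \<Rightarrow> 'e::finite) \<Rightarrow> real)"
  obtains B where "B \<ge> 0" "\<And>w. \<bar>f w\<bar> \<le> B"
proof -
  obtain w where w: "\<And>w'. f w \<le> f w'" using ucont_attains_inf[OF assms] by blast
  obtain v where v: "\<And>w'. - f v \<le> - f w'" using ucont_attains_inf[OF ucont_minus[OF assms]] by blast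
  have "\<bar>f u\<bar> \<le> \<bar>f w\<bar> + \<bar>f v\<bar>" for u using w[of u] v[of u] by linarith
  then show thesis using that[of "\<bar>f w\<bar> + \<bar>f v\<bar>"] by auto
qed

lemma ucont_const: "ucont (\<lambda>w. c)"
  by (auto simp: ucont_def)

lemma ucont_add:
  assumes "ucont f" "ucont g" shows "ucont (\<lambda>w. f w + g w)"
  unfolding ucont_def
proof (intro allI impI)
  fix e :: real assume e: "e > 0"
  obtain N where N: "\<And>w w'. agree N w w' \<Longrightarrow> \<bar>f w - f w'\<bar> \<le> e/2" using ucontD[OF assms(1), of "e/2"] e by auto
  obtain M where M: "\<And>w w'. agree M w w' \<Longrightarrow> \<bar>g w - g w'\<bar> \<le> e/2" using ucontD[OF assms(2), of "e/2"] e by auto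
  have "\<bar>f w + g w - (f w' + g w')\<bar> \<le> e" if a: "agree (max N M) w w'" for w w'
  proof -
    have "\<bar>f w - f w'\<bar> \<le> e/2" "\<bar>g w - g w'\<bar> \<le> e/2"
      using N[OF agree_mono[OF a]] M[OF agree_mono[OF a]] by auto
    then show ?thesis by linarith
  qed
  then show "\<exists>N. \<forall>w w'. agree N w w' \<longrightarrow> \<bar>f w + g w - (f w' + g w')\<bar> \<le> e" by blast
qed

lemma ucont_diff: "ucont f \<Longrightarrow> ucont g \<Longrightarrow> ucont (\<lambda>w. f w - g w)"
  using ucont_add[OF _ ucont_minus, of f g] by simp

lemma ucont_sum: "(\<And>i. i \<in> I \<Longrightarrow> ucont (f i)) \<Longrightarrow> ucont (\<lambda>w. \<Sum>i\<in>I. f i w)"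
  by (induction I rule: infinite_finite_induct) (auto intro: ucont_const ucont_add)

lemma ucont_comp:
  assumes f: "ucont f" and T: "\<And>N. \<exists>M. \<forall>w w'. agree M w w' \<longrightarrow> agree N (T w) (T w')"
  shows "ucont (\<lambda>w. f (T w))"
  using assms unfolding ucont_def by meson

lemma agree_shiftp: "agree (N + nat \<bar>k\<bar>) w w' \<Longrightarrow> agree N (shiftp k w) (shiftp k w')"
  by (auto simp: agree_def shiftp_def)

lemma ucont_shiftp: "ucont f \<Longrightarrow> ucont (\<lambda>w. f (shiftp k w))"
  using agree_shiftp by (intro ucont_comp[of f "shiftp k"]) blast+

lemma ucont_glue: "ucont f \<Longrightarrow> ucont (\<lambda>w. f (glue L x w))"
proof (rule ucont_comp[of f "glue L x"])
  show "\<exists>M. \<forall>w w'. agree M w w' \<longrightarrow> agree N (glue L x w) (glue L x w')" for N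
    by (intro exI[of _ N]) (auto simp: agree_def glue_def)
qed

lemma ucont_upd: "ucont f \<Longrightarrow> ucont (\<lambda>w. f (w(j := a)))"
proof (rule ucont_comp[of f "\<lambda>w. w(j := a)"])
  show "\<exists>M. \<forall>w w'. agree M w w' \<longrightarrow> agree N (w(j := a)) (w'(j := a))" for N
    by (intro exI[of _ N]) (auto simp: agree_def)
qed

lemma ucont_real_comp:
  fixes f :: "(int \<Rightarrow> 'e::finite) \<Rightarrow> real"
  assumes f: "ucont f" and h: "continuous_on S h" and S: "range f \<subseteq> S"
  shows "ucont (\<lambda>w. h (f w))"
proof -
  have "continuous_map Omega_top (top_of_set S) f"
    using f S by (simp add: continuous_map_iff_ucont[symmetric] continuous_map_in_subtopology image_subset_iff)
  moreover have "continuous_map (top_of_set S) euclideanreal h" using h by simp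
  ultimately have "continuous_map Omega_top euclideanreal (h \<circ> f)" by (rule continuous_map_compose)
  then show ?thesis by (simp add: continuous_map_iff_ucont o_def)
qed

lemma ucont_mult:
  fixes f :: "(int \<Rightarrow> 'e::finite) \<Rightarrow> real"
  assumes "ucont f" "ucont g" shows "ucont (\<lambda>w. f w * g w)"
  using assms by (simp add: continuous_map_iff_ucont[symmetric] continuous_map_real_mult)

lemma ucont_local:
  assumes "\<And>w w'. agree N w w' \<Longrightarrow> f w = f w'" shows "ucont f"
  using assms unfolding ucont_def by (metis abs_0 diff_self less_imp_le)

lemma ucont_uniform_limit:
  assumes g: "\<And>n::nat. ucont (g n)"
    and lim: "\<And>e. e > 0 \<Longrightarrow> \<exists>n. \<forall>w. \<bar>g n w - f w\<bar> \<le> e"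
  shows "ucont f"
  unfolding ucont_def
proof (intro allI impI)
  fix e :: real assume e: "e > 0"
  obtain n where n: "\<And>w. \<bar>g n w - f w\<bar> \<le> e/3" using lim[of "e/3"] e by auto
  obtain N where N: "\<And>w w'. agree N w w' \<Longrightarrow> \<bar>g n w - g n w'\<bar> \<le> e/3" using ucontD[OF g, of "e/3" n] e by auto
  have "\<bar>f w - f w'\<bar> \<le> e" if "agree N w w'" for w w'
    using N[OF that] n[of w] n[of w'] by linarith
  then show "\<exists>N. \<forall>w w'. agree N w w' \<longrightarrow> \<bar>f w - f w'\<bar> \<le> e" by blast
qed

section \<open>Shifts, Borel sets and functions of finitely many sites\<close>

lemma funpow_shift: "(shift ^^ k) w = shiftp (int k) w"
  by (induction k) (auto simp: shift_def shiftp_def algebra_simps)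

lemma shiftp_0 [simp]: "shiftp 0 w = w" and shiftp_shiftp [simp]: "shiftp a (shiftp b w) = shiftp (a + b) w"
  by (auto simp: shiftp_def algebra_simps)

lemma openin_sets_Omega: "openin Omega_top U \<Longrightarrow> U \<in> sets Omega_borel"
  by (simp add: Omega_borel_def)

lemma local_set_sets:
  assumes "\<And>w w'. agree N w w' \<Longrightarrow> w \<in> A \<Longrightarrow> w' \<in> A"
  shows "A \<in> sets Omega_borel"
  using assms by (intro openin_sets_Omega) (auto simp: openin_Omega_top_iff)

lemma space_Omega_borel [simp]: "space Omega_borel = UNIV"
  by (simp add: Omega_borel_def)

lemma ucont_measurable:
  assumes "ucont f" shows "f \<in> borel_measurable Omega_borel"
proof (rule borel_measurableI)
  fix S :: "real set" assume "open S"
  then have "openin Omega_top {x \<in> topspace Omega_top. f x \<in> S}"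
    using assms by (intro openin_continuous_map_preimage[of _ euclideanreal]) (auto simp: continuous_map_iff_ucont)
  then show "f -` S \<inter> space Omega_borel \<in> sets Omega_borel"
    by (auto simp: vimage_def dest: openin_sets_Omega)
qed

lemma finite_range_local:
  fixes g :: "(int \<Rightarrow> 'e::finite) \<Rightarrow> 'b"
  assumes g: "\<And>w w'. (\<forall>i\<in>F. w i = w' i) \<Longrightarrow> g w = g w'" and F: "finite F"
  shows "finite (range g)"
proof -
  have "range g \<subseteq> g ` (PiE F (\<lambda>_. UNIV))"
  proof safe
    fix w
    have "g w = g (restrict w F)" by (rule g) simp
    then show "g w \<in> g ` (PiE F (\<lambda>_. UNIV))" by (intro image_eqI) auto
  qed
  moreover have "finite (PiE F (\<lambda>_. UNIV :: 'e set))" using F by (intro finite_PiE) auto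
  ultimately show ?thesis by (meson finite_imageI finite_subset)
qed

lemma local_measurable:
  assumes g: "\<And>w w'. agree N w w' \<Longrightarrow> g w = g w'"
  shows "g \<in> measurable Omega_borel (count_space UNIV)"
proof (rule measurableI)
  fix A show "g -` A \<inter> space Omega_borel \<in> sets Omega_borel"
    using g by (intro local_set_sets[of N]) fastforce
qed auto

section \<open>Approximation of partitions by local ones\<close>

definition approximable :: "(int \<Rightarrow> 'e::finite) measure \<Rightarrow> (int \<Rightarrow> 'e) set \<Rightarrow> bool" where
  "approximable mu A \<longleftrightarrow> (\<forall>e>0. \<exists>N B. (\<forall>w w'. agree N w w' \<longrightarrow> w \<in> B \<longrightarrow> w' \<in> B)
      \<and> measure mu ((A - B) \<union> (B - A)) \<le> e)"

text \<open>Sets determined by a finite window form an algebra generating the Borel sets. The proof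
  is induction over the generated sigma-algebra: open sets are increasing unions of local sets,
  complements keep the symmetric difference, and a countable union is cut off at a finite
  stage.\<close>

lemma approximable_sets:
  assumes mu: "prob_space mu" "sets mu = sets Omega_borel" and A: "A \<in> sets Omega_borel"
  shows "approximable mu A"
proof -
  interpret prob_space mu by fact
  have loc: "B \<in> sets mu" if "\<forall>w w'. agree N w w' \<longrightarrow> w \<in> B \<longrightarrow> w' \<in> B" for B N
    using that mu(2) by (auto intro!: local_set_sets[of N])
  have "A \<in> sigma_sets UNIV {U. openin Omega_top U}" using A by (simp add: Omega_borel_def)
  then have "A \<in> sets mu \<and> approximable mu A"
  proof (induction rule: sigma_sets.induct)
    case (Basic U)
    then have U: "openin Omega_top U" by simp
    then have Us: "U \<in> sets mu" using mu(2) openin_sets_Omega by auto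
    \<comment> \<open>\<open>V N\<close> collects the points whose window of radius N already forces
      membership in U; openness of U says that these sets exhaust it.\<close>
    define V where "V = (\<lambda>N. {w. \<forall>w'. agree N w w' \<longrightarrow> w' \<in> U})"
    have VU: "V N \<subseteq> U" for N by (auto simp: V_def)
    have Vl: "\<forall>w w'. agree N w w' \<longrightarrow> w \<in> V N \<longrightarrow> w' \<in> V N" for N
      by (auto simp: V_def agree_def)
    have Vs: "V N \<in> sets mu" for N using loc[OF Vl] .
    have inc: "incseq V" by (auto simp: incseq_def V_def intro: agree_mono)
    have UV: "(\<Union>N. V N) = U"
      using VU U unfolding openin_Omega_top_iff by (fastforce simp: V_def)
    have lim: "(\<lambda>N. measure mu (V N)) \<longlonglongrightarrow> measure mu U"
      using finite_Lim_measure_incseq[of V] Vs inc UV by auto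
    have "approximable mu U" unfolding approximable_def
    proof (intro allI impI)
      fix e :: real assume "e > 0"
      then obtain N where N: "norm (measure mu (V N) - measure mu U) < e"
        using LIMSEQ_D[OF lim] by blast
      have "measure mu ((U - V N) \<union> (V N - U)) = measure mu (U - V N)"
        using VU[of N] by (metis Diff_eq_empty_iff Un_empty_right)
      also have "\<dots> = measure mu U - measure mu (V N)"
        using Us Vs VU by (intro finite_measure_Diff) auto
      finally show "\<exists>N B. (\<forall>w w'. agree N w w' \<longrightarrow> w \<in> B \<longrightarrow> w' \<in> B)
          \<and> measure mu ((U - B) \<union> (B - U)) \<le> e"
        using N Vl[of N] by (intro exI[of _ N] exI[of _ "V N"]) auto
    qed
    with Us show ?case by simp
  next
    case Empty
    show ?case by (auto simp: approximable_def intro!: exI[of _ "{}"])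
  next
    case (Compl A)
    have "approximable mu (UNIV - A)" unfolding approximable_def
    proof (intro allI impI)
      fix e :: real assume "e > 0"
      then obtain N B where B: "\<forall>w w'. agree N w w' \<longrightarrow> w \<in> B \<longrightarrow> w' \<in> B"
          "measure mu ((A - B) \<union> (B - A)) \<le> e" using Compl unfolding approximable_def by blast
      have eq: "((UNIV - A) - (UNIV - B)) \<union> ((UNIV - B) - (UNIV - A)) = (A - B) \<union> (B - A)" by auto
      have "\<forall>w w'. agree N w w' \<longrightarrow> w \<in> UNIV - B \<longrightarrow> w' \<in> UNIV - B"
        using B(1) agree_sym by blast
      then show "\<exists>N B. (\<forall>w w'. agree N w w' \<longrightarrow> w \<in> B \<longrightarrow> w' \<in> B)
          \<and> measure mu (((UNIV - A) - B) \<union> (B - (UNIV - A))) \<le> e"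
        using B(2) unfolding eq[symmetric] by blast
    qed
    moreover have "UNIV - A \<in> sets mu"
      using sets.compl_sets[of A mu] Compl mu(2) sets_eq_imp_space_eq[of mu Omega_borel] by auto
    ultimately show ?case by simp
  next
    case (Union A)
    then have As: "\<And>i. A i \<in> sets mu" and Aa: "\<And>i. approximable mu (A i)" by auto
    let ?A = "\<Union>i. A i"
    have "approximable mu ?A" unfolding approximable_def
    proof (intro allI impI)
      fix e :: real assume e: "e > 0"
      define V where "V = (\<lambda>n::nat. \<Union>i<n. A i)"
      have Vs: "V n \<in> sets mu" for n using As by (auto simp: V_def)
      have inc: "incseq V" unfolding incseq_def V_def by (meson UN_mono lessThan_subset_iff order_refl)
      have UV: "(\<Union>n. V n) = ?A" by (auto simp: V_def)
      have lim: "(\<lambda>N. measure mu (V N)) \<longlonglongrightarrow> measure mu ?A"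
        using finite_Lim_measure_incseq[of V] Vs inc UV by auto
      obtain n where n: "norm (measure mu (V n) - measure mu ?A) < e/2"
        using LIMSEQ_D[OF lim half_gt_zero[OF e]] by blast
      have n': "measure mu (?A - V n) \<le> e/2"
      proof -
        have "measure mu (?A - V n) = measure mu ?A - measure mu (V n)"
        proof (rule finite_measure_Diff)
          show "?A \<in> sets mu" using As by blast
          show "V n \<in> sets mu" by (rule Vs)
          show "V n \<subseteq> ?A" by (auto simp: V_def)
        qed
        then show ?thesis using n unfolding real_norm_def by linarith
      qed
      \<comment> \<open>Half of e goes to the tail of the union, the other half is shared by the n
        retained sets; the added 1 covers n = 0.\<close>
      define d where "d = e / (2 * (real n + 1))"
      have d: "d > 0" using e by (simp add: d_def)
      have "\<forall>i. \<exists>N B. (\<forall>w w'. agree N w w' \<longrightarrow> w \<in> B \<longrightarrow> w' \<in> B)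
          \<and> measure mu ((A i - B) \<union> (B - A i)) \<le> d"
        by (rule allI) (rule Aa[unfolded approximable_def, THEN spec, THEN mp, OF d])
      then obtain N B where B: "\<And>i w w'. agree (N i) w w' \<Longrightarrow> w \<in> B i \<Longrightarrow> w' \<in> B i"
        and Bd: "\<And>i. measure mu ((A i - B i) \<union> (B i - A i)) \<le> d" by metis
      have Bs: "B i \<in> sets mu" for i
        by (rule loc[of "N i"]) (use B in blast)
      define M where "M = (\<Sum>i<n. N i)"
      define C where "C = (\<Union>i<n. B i)"
      have C: "\<forall>w w'. agree M w w' \<longrightarrow> w \<in> C \<longrightarrow> w' \<in> C"
      proof (intro allI impI)
        fix w w' assume a: "agree M w w'" and "w \<in> C"
        then obtain i where i: "i < n" "w \<in> B i" by (auto simp: C_def)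
        have "N i \<le> M" unfolding M_def using i(1) by (intro member_le_sum) auto
        then show "w' \<in> C" using B[OF agree_mono[OF a] i(2)] i(1) by (auto simp: C_def)
      qed
      have "measure mu ((?A - C) \<union> (C - ?A)) \<le> measure mu ((?A - V n) \<union> (\<Union>i<n. (A i - B i) \<union> (B i - A i)))"
        using As Vs Bs by (intro finite_measure_mono) (auto simp: C_def V_def)
      also have "\<dots> \<le> measure mu (?A - V n) + measure mu (\<Union>i<n. (A i - B i) \<union> (B i - A i))"
        using As Vs Bs by (intro measure_Un_le) auto
      also have "measure mu (\<Union>i<n. (A i - B i) \<union> (B i - A i)) \<le> (\<Sum>i<n. measure mu ((A i - B i) \<union> (B i - A i)))"
        using As Bs by (intro finite_measure_subadditive_finite) auto
      also have "\<dots> \<le> (\<Sum>i<n. d)" by (intro sum_mono Bd)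
      also have "\<dots> \<le> e/2" using e by (simp add: d_def field_simps)
      finally have "measure mu ((?A - C) \<union> (C - ?A)) \<le> e" using n' by linarith
      then show "\<exists>N B. (\<forall>w w'. agree N w w' \<longrightarrow> w \<in> B \<longrightarrow> w' \<in> B) \<and> measure mu ((?A - B) \<union> (B - ?A)) \<le> e"
        using C by blast
    qed
    moreover have "?A \<in> sets mu" using As by auto
    ultimately show ?case by simp
  qed
  then show ?thesis by simp
qed

text \<open>Each fibre of \<open>xi\<close> is approximated up to e / K, with K the number of
  values, and g picks the least value whose approximating set contains the point. Outside the
  symmetric differences exactly one of these sets does, and g agrees with \<open>xi\<close>.\<close>

lemma partition_approximable:
  fixes xi :: "(int \<Rightarrow> 'e::finite) \<Rightarrow> nat"
  assumes mu: "prob_space mu" "sets mu = sets Omega_borel"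
    and xi: "xi \<in> measurable mu (count_space UNIV)" and fin: "finite (range xi)" and e: "e > 0"
  obtains N g where "\<And>w w'. agree N w w' \<Longrightarrow> g w = g w'" "range g \<subseteq> range xi"
    "measure mu {w. xi w \<noteq> g w} \<le> e"
proof -
  interpret prob_space mu by fact
  have sp: "space mu = UNIV" using sets_eq_imp_space_eq[OF mu(2)] by simp
  have loc: "B \<in> sets mu" if "\<forall>w w'. agree N w w' \<longrightarrow> w \<in> B \<longrightarrow> w' \<in> B" for B N
    using that mu(2) by (auto intro!: local_set_sets[of N])
  define K where "K = real (card (range xi))"
  have K: "K > 0" using fin by (simp add: K_def card_gt_0_iff)
  define A where "A = (\<lambda>k. xi -` {k})"
  have As: "A k \<in> sets mu" for k using measurable_sets[OF xi, of "{k}"] by (simp add: A_def sp)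
  have "\<forall>k. \<exists>N B. (\<forall>w w'. agree N w w' \<longrightarrow> w \<in> B \<longrightarrow> w' \<in> B)
      \<and> measure mu ((A k - B) \<union> (B - A k)) \<le> e / K"
    using approximable_sets[OF mu] As mu(2) e K unfolding approximable_def by (metis divide_pos_pos)
  then obtain N B where B: "\<And>k w w'. agree (N k) w w' \<Longrightarrow> w \<in> B k \<Longrightarrow> w' \<in> B k"
    and Bd: "\<And>k. measure mu ((A k - B k) \<union> (B k - A k)) \<le> e / K" by metis
  have Bs: "B k \<in> sets mu" for k using B by (intro loc[of "N k"]) blast
  define M where "M = (\<Sum>k\<in>range xi. N k)"
  have BM: "w \<in> B k \<longleftrightarrow> w' \<in> B k" if a: "agree M w w'" and k: "k \<in> range xi" for k w w'
  proof -
    have "N k \<le> M" unfolding M_def using fin k by (intro member_le_sum) auto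
    then have "agree (N k) w w'" using a agree_mono by blast
    then show ?thesis using B agree_sym by blast
  qed
  \<comment> \<open>Points in none of the approximating sets receive an arbitrary value of
    \<open>xi\<close>, which keeps the range of g inside that of \<open>xi\<close>.\<close>
  define g where "g = (\<lambda>w. if \<exists>k\<in>range xi. w \<in> B k then (LEAST k. k \<in> range xi \<and> w \<in> B k) else xi undefined)"
  have g1: "g w = g w'" if "agree M w w'" for w w'
  proof -
    have "(\<lambda>k. k \<in> range xi \<and> w \<in> B k) = (\<lambda>k. k \<in> range xi \<and> w' \<in> B k)" using BM[OF that] by auto
    moreover have "(\<exists>k\<in>range xi. w \<in> B k) \<longleftrightarrow> (\<exists>k\<in>range xi. w' \<in> B k)" using BM[OF that] by auto
    ultimately show ?thesis unfolding g_def by presburger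
  qed
  have g2: "range g \<subseteq> range xi"
  proof -
    have "(LEAST k. k \<in> range xi \<and> w \<in> B k) \<in> range xi" if "\<exists>k\<in>range xi. w \<in> B k" for w
      using that LeastI_ex[of "\<lambda>k. k \<in> range xi \<and> w \<in> B k"] by blast
    then show ?thesis by (auto simp: g_def)
  qed
  have sub: "{w. xi w \<noteq> g w} \<subseteq> (\<Union>k\<in>range xi. (A k - B k) \<union> (B k - A k))"
  proof (rule subsetI, rule ccontr)
    fix w assume w: "w \<in> {w. xi w \<noteq> g w}" and n: "w \<notin> (\<Union>k\<in>range xi. (A k - B k) \<union> (B k - A k))"
    have iff: "w \<in> B k \<longleftrightarrow> xi w = k" if "k \<in> range xi" for k
    proof -
      have "w \<notin> (A k - B k) \<union> (B k - A k)" using n that by blast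
      then show ?thesis by (auto simp: A_def)
    qed
    have "(\<lambda>k. k \<in> range xi \<and> w \<in> B k) = (\<lambda>k. k = xi w)"
      by (rule ext) (use iff in auto)
    moreover have "\<exists>k\<in>range xi. w \<in> B k" using iff[of "xi w"] by blast
    ultimately have "g w = xi w" unfolding g_def by (simp add: Least_equality)
    then show False using w by simp
  qed
  have "measure mu {w. xi w \<noteq> g w} \<le> measure mu (\<Union>k\<in>range xi. (A k - B k) \<union> (B k - A k))"
    using As Bs fin by (intro finite_measure_mono sub sets.finite_UN) auto
  also have "\<dots> \<le> (\<Sum>k\<in>range xi. measure mu ((A k - B k) \<union> (B k - A k)))"
    using As Bs fin by (intro finite_measure_subadditive_finite) auto
  also have "\<dots> \<le> (\<Sum>k\<in>range xi. e / K)" by (intro sum_mono Bd)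
  also have "\<dots> = e" using K by (simp add: K_def)
  finally show thesis using that[OF g1 g2] by blast
qed

section \<open>The relative energy\<close>

lemma finite_diff_shiftp: "finite {i. z i \<noteq> y i} \<Longrightarrow> finite {i. shiftp k z i \<noteq> shiftp k y i}"
  by (rule finite_subset[of _ "(\<lambda>i. i - k) ` {i. z i \<noteq> y i}"])
     (auto simp: shiftp_def image_iff intro!: exI[of _ "_ + k"])

lemma sum_int_shift_up:
  fixes h :: "int \<Rightarrow> real" assumes "a \<le> b + 1"
  shows "(\<Sum>i\<in>{a..b}. h (i + 1)) = (\<Sum>i\<in>{a..b}. h i) - h a + h (b + 1)"
proof -
  have "(\<Sum>i\<in>{a..b}. h (i + 1)) = (\<Sum>i\<in>{a+1..b+1}. h i)"
    by (rule sum.reindex_bij_witness[of _ "\<lambda>i. i - 1" "\<lambda>i. i + 1"]) auto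
  moreover have "(\<Sum>i\<in>{a..b+1}. h i) = (\<Sum>i\<in>{a+1..b+1}. h i) + h a"
    using assms by (subst sum.remove[of _ a]) (auto intro!: arg_cong[where f = "sum h"])
  moreover have "(\<Sum>i\<in>{a..b+1}. h i) = (\<Sum>i\<in>{a..b}. h i) + h (b + 1)"
    using assms by (subst sum.remove[of _ "b + 1"]) (auto intro!: arg_cong[where f = "sum h"])
  ultimately show ?thesis by simp
qed

lemma shiftp_upd: "shiftp j (w(j := a)) = (shiftp j w)(0 := a)"
  by (auto simp: shiftp_def)

lemma glue_insert: "glue (insert j L) x w = (glue L x w)(j := x j)"
  by (auto simp: glue_def)

text \<open>Moving the window by one site exchanges one end term for another, a change of at most 2
  B.\<close>

lemma sum_window_shift:
  fixes h :: "int \<Rightarrow> real"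
  assumes "\<And>i. \<bar>h i\<bar> \<le> B"
  shows "\<bar>(\<Sum>s<n. h (int s + a)) - (\<Sum>s<n. h (int s + a + int k))\<bar> \<le> 2 * real k * B"
proof (induction k)
  case (Suc k)
  have "(\<Sum>s<n. h (int s + a + int (Suc k))) - (\<Sum>s<n. h (int s + a + int k)) = h (int n + a + int k) - h (a + int k)"
    using sum_lessThan_telescope[of "\<lambda>s. h (int s + a + int k)" n]
    by (simp add: sum_subtractf[symmetric] algebra_simps)
  with Suc assms[of "int n + a + int k"] assms[of "a + int k"] show ?case
    by (simp add: algebra_simps)
qed simp

locale ext_potential =
  fixes phi :: "(int \<Rightarrow> 'e::finite) \<Rightarrow> real"
  assumes ucont_phi: "ucont phi" and extensible_phi: "extensible phi"
begin

text \<open>For configurations that differ at most at the origin these are the partial sums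
  \<open>rho\<close>, which is where extensibility applies.\<close>

definition W :: "nat \<Rightarrow> (int \<Rightarrow> 'e) \<Rightarrow> (int \<Rightarrow> 'e) \<Rightarrow> real" where
  "W N z y = (\<Sum>i\<in>{- int N..int N}. phi (shiftp i z) - phi (shiftp i y))"

text \<open>The value is meaningful when z and y differ at finitely many sites;
  \<open>W_tendsto_R\<close> then provides convergence.\<close>

definition R :: "(int \<Rightarrow> 'e) \<Rightarrow> (int \<Rightarrow> 'e) \<Rightarrow> real" where
  "R z y = lim (\<lambda>N. W N z y)"

text \<open>Once the shift exceeds the sites of disagreement by the radius of uniform continuity,
  both arguments agree on that window. The two directions serve the two end terms that appear when a
  summation window is moved.\<close>

lemma energy_difference_decay:
  assumes fin: "finite {i. z i \<noteq> y i}"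
  shows "((\<lambda>n. phi (shiftp (int n + k) z) - phi (shiftp (int n + k) y)) \<longlonglongrightarrow> 0)
     \<and> ((\<lambda>n. phi (shiftp (k - int n) z) - phi (shiftp (k - int n) y)) \<longlonglongrightarrow> 0)"
proof -
  have main: "\<exists>K. \<forall>l. \<bar>l\<bar> \<ge> K \<longrightarrow> \<bar>phi (shiftp l z) - phi (shiftp l y)\<bar> < e" if e: "e > 0" for e
  proof -
    obtain N where N: "\<And>w w'. agree N w w' \<Longrightarrow> \<bar>phi w - phi w'\<bar> \<le> e/2"
      using ucontD[OF ucont_phi half_gt_zero[OF e]] by blast
    define D where "D = (\<Sum>i\<in>{i. z i \<noteq> y i}. \<bar>i\<bar>)"
    have D: "\<bar>i\<bar> \<le> D" if "z i \<noteq> y i" for i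
      unfolding D_def by (rule member_le_sum) (use fin that in auto)
    have "\<bar>phi (shiftp l z) - phi (shiftp l y)\<bar> < e" if l: "\<bar>l\<bar> \<ge> int N + D + 1" for l
    proof -
      have "agree N (shiftp l z) (shiftp l y)"
        unfolding agree_def shiftp_def
      proof (intro allI impI, rule ccontr)
        fix i assume "\<bar>i\<bar> \<le> int N" "z (i + l) \<noteq> y (i + l)"
        with D[of "i + l"] l show False by linarith
      qed
      then have "\<bar>phi (shiftp l z) - phi (shiftp l y)\<bar> \<le> e/2" by (rule N)
      then show ?thesis using e by linarith
    qed
    then show ?thesis by blast
  qed
  show ?thesis
  proof (intro conjI LIMSEQ_I)
    fix e :: real assume "e > 0"
    then obtain K where K: "\<And>l. \<bar>l\<bar> \<ge> K \<Longrightarrow> \<bar>phi (shiftp l z) - phi (shiftp l y)\<bar> < e" using main by blast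
    show "\<exists>no. \<forall>n\<ge>no. norm (phi (shiftp (int n + k) z) - phi (shiftp (int n + k) y) - 0) < e"
      by (rule exI[of _ "nat (\<bar>K\<bar> + \<bar>k\<bar>)"]) (auto intro!: K)
    show "\<exists>no. \<forall>n\<ge>no. norm (phi (shiftp (k - int n) z) - phi (shiftp (k - int n) y) - 0) < e"
      by (rule exI[of _ "nat (\<bar>K\<bar> + \<bar>k\<bar>)"]) (auto intro!: K)
  qed
qed

lemma W_shift_up:
  "W N (shiftp 1 z) (shiftp 1 y) = W N z y - (phi (shiftp (0 - int N) z) - phi (shiftp (0 - int N) y))
      + (phi (shiftp (int N + 1) z) - phi (shiftp (int N + 1) y))"
  unfolding W_def
  using sum_int_shift_up[of "- int N" "int N" "\<lambda>i. phi (shiftp i z) - phi (shiftp i y)"] by simp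

lemma W_shift_tendsto_up:
  assumes fin: "finite {i. z i \<noteq> y i}"
  shows "(\<lambda>N. W N z y) \<longlonglongrightarrow> l \<longleftrightarrow> (\<lambda>N. W N (shiftp 1 z) (shiftp 1 y)) \<longlonglongrightarrow> l"
proof -
  define d where "d = (\<lambda>N. (phi (shiftp (0 - int N) z) - phi (shiftp (0 - int N) y))
      - (phi (shiftp (int N + 1) z) - phi (shiftp (int N + 1) y)))"
  have d: "d \<longlonglongrightarrow> 0"
    using tendsto_diff[OF conjunct2[OF energy_difference_decay[OF fin, of 0]]
        conjunct1[OF energy_difference_decay[OF fin, of 1]]]
    unfolding d_def by simp
  have eq: "(\<lambda>N. W N z y) = (\<lambda>N. W N (shiftp 1 z) (shiftp 1 y) + d N)"
    by (auto simp: W_shift_up d_def)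
  have eq2: "(\<lambda>N. W N (shiftp 1 z) (shiftp 1 y)) = (\<lambda>N. W N z y - d N)"
    by (auto simp: W_shift_up d_def)
  show ?thesis
  proof
    assume "(\<lambda>N. W N z y) \<longlonglongrightarrow> l"
    from tendsto_diff[OF this d] show "(\<lambda>N. W N (shiftp 1 z) (shiftp 1 y)) \<longlonglongrightarrow> l" unfolding eq2 by simp
  next
    assume "(\<lambda>N. W N (shiftp 1 z) (shiftp 1 y)) \<longlonglongrightarrow> l"
    from tendsto_add[OF this d] show "(\<lambda>N. W N z y) \<longlonglongrightarrow> l" unfolding eq by simp
  qed
qed

text \<open>Moving the centre of the window changes the partial sums by end terms that tend to zero.
  Hence extensibility, which is formulated at site 0, becomes available at every site.\<close>

lemma W_shift_tendsto:
  assumes fin: "finite {i. z i \<noteq> y i}"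
  shows "(\<lambda>N. W N (shiftp k z) (shiftp k y)) \<longlonglongrightarrow> l \<longleftrightarrow> (\<lambda>N. W N z y) \<longlonglongrightarrow> l"
proof (induction k rule: int_induct[of _ 0])
  case (step1 k)
  have "(\<lambda>N. W N (shiftp (k + 1) z) (shiftp (k + 1) y)) \<longlonglongrightarrow> l \<longleftrightarrow> (\<lambda>N. W N (shiftp k z) (shiftp k y)) \<longlonglongrightarrow> l"
    using W_shift_tendsto_up[OF finite_diff_shiftp[OF fin, of k], of l] by (simp add: add.commute)
  with step1 show ?case by simp
next
  case (step2 k)
  have "(\<lambda>N. W N (shiftp (k - 1) z) (shiftp (k - 1) y)) \<longlonglongrightarrow> l \<longleftrightarrow> (\<lambda>N. W N (shiftp k z) (shiftp k y)) \<longlonglongrightarrow> l"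
    using W_shift_tendsto_up[OF finite_diff_shiftp[OF fin, of "k - 1"], of l] by simp
  with step2 show ?case by simp
qed simp

text \<open>Choosing the second symbol as \<open>w 0\<close> turns \<open>rho\<close> into a
  comparison with w itself. Since the alphabet is finite, one index M serves all pairs of
  symbols.\<close>

lemma site_uniform:
  assumes e: "e > 0"
  shows "\<exists>M. \<forall>n\<ge>M. \<forall>a w. \<bar>W n (w(0 := a)) w - R (w(0 := a)) w\<bar> < e"
    and "(\<lambda>N. W N (w(0 := a)) w) \<longlonglongrightarrow> R (w(0 := a)) w"
proof -
  obtain l where l: "\<And>a a'. uniform_limit UNIV (rho phi a a') (l a a') sequentially"
    using extensible_phi unfolding extensible_def uniformly_convergent_on_def by metis
  have rW: "rho phi a (w 0) n w = W n (w(0 := a)) w" for a n w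
    by (simp add: rho_def W_def)
  have conv: "(\<lambda>N. W N (w(0 := a)) w) \<longlonglongrightarrow> l a (w 0) w" for w a
    using tendsto_uniform_limitI[OF l[of a "w 0"], of w] by (simp add: rW)
  have R: "R (w(0 := a)) w = l a (w 0) w" for w a
    using limI[OF conv] by (simp add: R_def)
  show "(\<lambda>N. W N (w(0 := a)) w) \<longlonglongrightarrow> R (w(0 := a)) w" using conv R by simp
  have "eventually (\<lambda>n. \<forall>w. dist (rho phi a a' n w) (l a a' w) < e) sequentially" for a a'
    using uniform_limitD[OF l e] by simp
  then have "eventually (\<lambda>n. \<forall>a a'. \<forall>w. dist (rho phi a a' n w) (l a a' w) < e) sequentially"
    by (intro eventually_all_finite) auto
  then obtain M where M: "\<And>n a a' w. n \<ge> M \<Longrightarrow> dist (rho phi a a' n w) (l a a' w) < e"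
    unfolding eventually_sequentially by blast
  have "\<bar>W n (w(0 := a)) w - R (w(0 := a)) w\<bar> < e" if "n \<ge> M" for n a w
    using M[OF that, of a "w 0" w] by (simp add: rW R dist_real_def)
  then show "\<exists>M. \<forall>n\<ge>M. \<forall>a w. \<bar>W n (w(0 := a)) w - R (w(0 := a)) w\<bar> < e" by blast
qed

lemma W_trans: "W N z y + W N y x = W N z x"
  by (simp add: W_def sum.distrib[symmetric])

lemma W_tendsto_R:
  assumes fin: "finite {i. z i \<noteq> y i}"
  shows "(\<lambda>N. W N z y) \<longlonglongrightarrow> R z y"
proof -
  have "convergent (\<lambda>N. W N z y)" if "finite L" "\<And>i. i \<notin> L \<Longrightarrow> z i = y i" for L z
    using that
  proof (induction L arbitrary: z rule: finite_induct)
    case empty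
    then have "z = y" by auto
    then show ?case by (simp add: W_def convergent_const)
  next
    case (insert j L)
    \<comment> \<open>Resetting site j to its value in y leaves a one-site difference, which a shift
      by j moves to the origin, and a remaining difference inside L for the induction
      hypothesis.\<close>
    let ?z = "z(j := y j)"
    have z: "z = ?z(j := z j)" by simp
    have "(\<lambda>N. W N (shiftp j (?z(j := z j))) (shiftp j ?z)) \<longlonglongrightarrow> R (shiftp j (?z(j := z j))) (shiftp j ?z)"
      unfolding shiftp_upd[of j ?z] by (rule site_uniform(2)[of 1]) simp
    moreover have "finite {i. (?z(j := z j)) i \<noteq> ?z i}" by (rule finite_subset[of _ "{j}"]) auto
    ultimately have 1: "convergent (\<lambda>N. W N z ?z)" using W_shift_tendsto[of "?z(j := z j)" ?z j]
      unfolding z[symmetric] convergent_def by blast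
    have 2: "convergent (\<lambda>N. W N ?z y)" by (rule insert.IH) (use insert.prems in auto)
    show ?case using convergent_add[OF 1 2] by (simp add: W_trans)
  qed
  from this[OF fin, of z] show ?thesis unfolding R_def by (simp add: convergent_LIMSEQ_iff)
qed

lemma R_refl [simp]: "R z z = 0"
  by (simp add: R_def W_def limI)

text \<open>The cocycle identity, inherited from the partial sums. It permits changing one site at a
  time here and changing the reference configuration of a kernel later.\<close>

lemma R_trans:
  assumes "finite {i. z i \<noteq> y i}" "finite {i. y i \<noteq> x i}"
  shows "R z y + R y x = R z x"
proof -
  have "(\<lambda>N. W N z x) \<longlonglongrightarrow> R z y + R y x"
    using tendsto_add[OF W_tendsto_R[OF assms(1)] W_tendsto_R[OF assms(2)]] by (simp add: W_trans)
  then show ?thesis unfolding R_def by (metis limI)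
qed

lemma R_shiftp:
  assumes "finite {i. z i \<noteq> y i}"
  shows "R (shiftp k z) (shiftp k y) = R z y"
  using W_tendsto_R[OF assms] W_shift_tendsto[OF assms, of k "R z y"] by (metis R_def limI)

text \<open>At the origin the limit of the continuous partial sums is uniform in w, hence
  continuous; shift invariance of R carries this to site j.\<close>

lemma ucont_R_site: "ucont (\<lambda>w. R (w(j := a)) w)"
proof -
  have "ucont (\<lambda>w. R (w(0 := a)) w)"
  proof (rule ucont_uniform_limit[where g = "\<lambda>n w. W n (w(0 := a)) w"])
    show "ucont (\<lambda>w. W n (w(0 := a)) w)" for n
      unfolding W_def
      by (intro ucont_sum ucont_diff ucont_upd[of "\<lambda>w. phi (shiftp _ w)"] ucont_shiftp ucont_phi)
    show "\<exists>n. \<forall>w. \<bar>W n (w(0 := a)) w - R (w(0 := a)) w\<bar> \<le> e" if "e > 0" for e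
      using site_uniform(1)[OF that] by (meson less_imp_le order_refl)
  qed
  from ucont_shiftp[OF this, of j] have "ucont (\<lambda>w. R (shiftp j (w(j := a))) (shiftp j w))"
    by (simp add: shiftp_upd)
  moreover have "R (shiftp j (w(j := a))) (shiftp j w) = R (w(j := a)) w" for w
    by (rule R_shiftp) (rule finite_subset[of _ "{j}"], auto)
  ultimately show ?thesis by simp
qed

lemma ucont_R_glue: "finite L \<Longrightarrow> ucont (\<lambda>w. R (glue L x w) w)"
proof (induction L rule: finite_induct)
  case empty
  have "glue {} x w = w" for w by (simp add: glue_def)
  then show ?case by (simp add: ucont_const)
next
  case (insert j L)
  have "R ((glue L x w)(j := x j)) (glue L x w) + R (glue L x w) w = R (glue (insert j L) x w) w" for w
    unfolding glue_insert
    by (rule R_trans; rule finite_subset[of _ "insert j L"]) (use insert in \<open>auto simp: glue_def\<close>)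
  moreover have "ucont (\<lambda>w. R ((glue L x w)(j := x j)) (glue L x w) + R (glue L x w) w)"
    by (intro ucont_add insert.IH ucont_glue[of "\<lambda>w. R (w(j := x j)) w"] ucont_R_site)
  ultimately show ?case by simp
qed

text \<open>
  With Z s equal to z left of s and to y from s on, R z y is the sum of the one-site energies
  R (Z (s+1)) (Z s). Each is approximated by a window of radius M around s; summing over s, the
  windows telescope except for their end terms, which see only z on the left and only y on the right.
\<close>

lemma R_birkhoff_bound:
  assumes e: "e > 0"
  shows "\<exists>C. \<forall>n z y. (\<forall>i. i \<notin> {0..<int n} \<longrightarrow> z i = y i)
     \<longrightarrow> \<bar>R z y - (birkhoff n phi z - birkhoff n phi y)\<bar> \<le> e * real n + C"
proof -
  obtain B where B: "B \<ge> 0" "\<And>w. \<bar>phi w\<bar> \<le> B" using ucont_bounded[OF ucont_phi] by blast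
  have e3: "e / 3 > 0" using e by simp
  obtain M1 where M1: "\<And>n a w. n \<ge> M1 \<Longrightarrow> \<bar>W n (w(0 := a)) w - R (w(0 := a)) w\<bar> < e/3"
    using site_uniform(1)[OF e3] by blast
  obtain N where N: "\<And>w w'. agree N w w' \<Longrightarrow> \<bar>phi w - phi w'\<bar> \<le> e/3"
    using ucontD[OF ucont_phi e3] by blast
  \<comment> \<open>M >= M1 makes a window of radius M compute each one-site energy up to e/3; M >=
    N keeps the end terms from seeing across the interface between z and y.\<close>
  define M where "M = max M1 N"
  define K where "K = (2 * real M + 1) * B"
  have "\<bar>R z y - (birkhoff n phi z - birkhoff n phi y)\<bar> \<le> e * real n + 4 * K"
    if zy: "\<And>i. i \<notin> {0..<int n} \<Longrightarrow> z i = y i" for n z y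
  proof -
    define Z where "Z = (\<lambda>s::nat. glue {..<int s} z y)"
    define F where "F = (\<lambda>i s. phi (shiftp (int s + i) (Z s)))"
    define G where "G = (\<lambda>s. \<Sum>i\<in>{- int M..int M}. F i s)"
    have Z0: "Z 0 = y" using zy by (auto simp: Z_def glue_def)
    have Zn: "Z n = z" using zy by (auto simp: Z_def glue_def)
    have ZS: "Z (Suc s) = (Z s)(int s := z (int s))" for s by (auto simp: Z_def glue_def)
    have fin: "finite {i. Z s i \<noteq> Z t i}" for s t
    proof (rule finite_subset)
      show "{i. Z s i \<noteq> Z t i} \<subseteq> {0..<int n}"
      proof (rule subsetI, rule ccontr)
        fix i assume "i \<in> {i. Z s i \<noteq> Z t i}" "i \<notin> {0..<int n}"
        with zy[of i] show False by (simp add: Z_def glue_def split: if_splits)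
      qed
    qed simp
    have R_sum: "R (Z m) (Z 0) = (\<Sum>s<m. R (Z (Suc s)) (Z s))" for m
    proof (induction m)
      case (Suc m)
      then show ?case using R_trans[OF fin fin, of "Suc m" m 0] by simp
    qed simp
    \<comment> \<open>\<open>G s\<close> is the window sum of \<open>Z s\<close> centred at s. The
      first half of W is a sum for \<open>Z (Suc s)\<close> still centred at s; recentring it at s +
      1 to obtain \<open>G (Suc s)\<close> costs one term at each end.\<close>
    have WF: "W M (shiftp (int s) (Z (Suc s))) (shiftp (int s) (Z s))
        = G (Suc s) - G s + (F (- int M - 1) (Suc s) - F (int M) (Suc s))" for s
    proof -
      have "(\<Sum>i\<in>{- int M..int M}. phi (shiftp (i + int s) (Z (Suc s)))) = (\<Sum>i\<in>{- int M..int M}. F (i - 1) (Suc s))"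
        by (intro sum.cong refl) (simp add: F_def algebra_simps)
      moreover have "(\<Sum>i\<in>{- int M..int M}. F i (Suc s)) = (\<Sum>i\<in>{- int M..int M}. F (i - 1) (Suc s)) - F (- int M - 1) (Suc s) + F (int M) (Suc s)"
        using sum_int_shift_up[of "- int M" "int M" "\<lambda>i. F (i - 1) (Suc s)"] by simp
      moreover have "(\<Sum>i\<in>{- int M..int M}. phi (shiftp (i + int s) (Z s))) = G s"
        unfolding G_def F_def by (intro sum.cong refl) (simp add: add.commute)
      ultimately show ?thesis
        unfolding W_def by (simp add: sum_subtractf G_def)
    qed
    have site: "\<bar>W M (shiftp (int s) (Z (Suc s))) (shiftp (int s) (Z s)) - R (Z (Suc s)) (Z s)\<bar> \<le> e/3" for s
    proof -
      have "R (Z (Suc s)) (Z s) = R (shiftp (int s) (Z (Suc s))) (shiftp (int s) (Z s))"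
        by (rule R_shiftp[OF fin, symmetric])
      moreover have "shiftp (int s) (Z (Suc s)) = (shiftp (int s) (Z s))(0 := z (int s))"
        unfolding ZS by (rule shiftp_upd)
      moreover have "M \<ge> M1" by (simp add: M_def)
      ultimately show ?thesis using M1[of M "shiftp (int s) (Z s)" "z (int s)"] by simp
    qed
    \<comment> \<open>The left end term sits at s - M, and its N-window reaches at most s, where
      \<open>Z (Suc s)\<close> still equals z. The right end term below sits at s + 1 + M, and its
      N-window starts at s + 1 or later, where y has taken over.\<close>
    have left: "\<bar>F (- int M - 1) (Suc s) - phi (shiftp (int s - int M) z)\<bar> \<le> e/3" for s
    proof -
      have "agree N (shiftp (int s - int M) (Z (Suc s))) (shiftp (int s - int M) z)"
        by (auto simp: agree_def shiftp_def Z_def glue_def M_def)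
      from N[OF this] show ?thesis by (simp add: F_def)
    qed
    have right: "\<bar>F (int M) (Suc s) - phi (shiftp (int s + (int M + 1)) y)\<bar> \<le> e/3" for s
    proof -
      have "agree N (shiftp (int s + (int M + 1)) (Z (Suc s))) (shiftp (int s + (int M + 1)) y)"
        by (auto simp: agree_def shiftp_def Z_def glue_def M_def)
      from N[OF this] show ?thesis by (simp add: F_def algebra_simps)
    qed
    have birk: "birkhoff n phi w = (\<Sum>s<n. phi (shiftp (int s) w))" for w
      by (simp add: birkhoff_def funpow_shift)
    have sums: "\<bar>sum f {..<n} - sum g {..<n}\<bar> \<le> real n * (e/3)" if "\<And>s. \<bar>f s - g s\<bar> \<le> e/3" for f g :: "nat \<Rightarrow> real"
    proof -
      have "\<bar>\<Sum>s<n. f s - g s\<bar> \<le> (\<Sum>s<n. \<bar>f s - g s\<bar>)" by (rule sum_abs)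
      also have "\<dots> \<le> (\<Sum>s<n. e/3)" by (intro sum_mono that)
      finally show ?thesis by (simp add: sum_subtractf)
    qed
    have a1: "\<bar>(\<Sum>s<n. W M (shiftp (int s) (Z (Suc s))) (shiftp (int s) (Z s))) - R z y\<bar> \<le> real n * (e/3)"
      using sums[OF site] R_sum[of n] by (simp add: Z0 Zn)
    have a2: "(\<Sum>s<n. W M (shiftp (int s) (Z (Suc s))) (shiftp (int s) (Z s)))
        = G n - G 0 + ((\<Sum>s<n. F (- int M - 1) (Suc s)) - (\<Sum>s<n. F (int M) (Suc s)))"
      by (simp add: WF sum.distrib sum_subtractf sum_lessThan_telescope[unfolded sum_subtractf])
    have G: "\<bar>G s\<bar> \<le> K" for s
    proof -
      have "\<bar>G s\<bar> \<le> (\<Sum>i\<in>{- int M..int M}. \<bar>F i s\<bar>)" unfolding G_def by (rule sum_abs)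
      also have "\<dots> \<le> (\<Sum>i\<in>{- int M..int M}. B)" by (intro sum_mono) (simp add: F_def B)
      finally show ?thesis by (simp add: K_def)
    qed
    have l2: "\<bar>(\<Sum>s<n. phi (shiftp (int s - int M) z)) - birkhoff n phi z\<bar> \<le> 2 * real M * B"
      using sum_window_shift[of "\<lambda>i. phi (shiftp i z)" B "- int M" n M] B(2) by (simp add: birk)
    have r2: "\<bar>(\<Sum>s<n. phi (shiftp (int s + (int M + 1)) y)) - birkhoff n phi y\<bar> \<le> 2 * (real M + 1) * B"
      using sum_window_shift[of "\<lambda>i. phi (shiftp i y)" B 0 n "M + 1"] B(2)
      by (simp add: birk abs_minus_commute algebra_simps)
    \<comment> \<open>The constant 4 K is made of K for each of \<open>G n\<close> and
      \<open>G 0\<close>, and 2 K for the two displaced Birkhoff sums together.\<close>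
    have KK: "2 * real M * B + 2 * (real M + 1) * B = 2 * K" by (simp add: K_def algebra_simps)
    have l1: "\<bar>(\<Sum>s<n. F (- int M - 1) (Suc s)) - (\<Sum>s<n. phi (shiftp (int s - int M) z))\<bar> \<le> real n * (e/3)"
      by (rule sums[OF left])
    have r1: "\<bar>(\<Sum>s<n. F (int M) (Suc s)) - (\<Sum>s<n. phi (shiftp (int s + (int M + 1)) y))\<bar> \<le> real n * (e/3)"
      by (rule sums[OF right])
    have "e * real n = 3 * (real n * (e/3))" by simp
    then show ?thesis
      using a1[unfolded a2 abs_le_iff] G[of n, unfolded abs_le_iff] G[of 0, unfolded abs_le_iff]
        l2[unfolded abs_le_iff] r2[unfolded abs_le_iff] l1[unfolded abs_le_iff] r1[unfolded abs_le_iff] KK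
      unfolding abs_le_iff by linarith
  qed
  then show ?thesis by blast
qed

end

text \<open>A term whose N-window lies inside [0, n) changes by at most e. At most 2 N terms are
  within N of an end, and each of these costs at most a further 2 B.\<close>

lemma birkhoff_local_bound:
  fixes phi :: "(int \<Rightarrow> 'e::finite) \<Rightarrow> real"
  assumes phi: "ucont phi" and e: "e > 0"
  shows "\<exists>C. \<forall>n w w'. (\<forall>i\<in>{0..<int n}. w i = w' i)
     \<longrightarrow> \<bar>birkhoff n phi w - birkhoff n phi w'\<bar> \<le> e * real n + C"
proof -
  obtain B where B: "B \<ge> 0" "\<And>w. \<bar>phi w\<bar> \<le> B" using ucont_bounded[OF phi] by blast
  obtain N where N: "\<And>w w'. agree N w w' \<Longrightarrow> \<bar>phi w - phi w'\<bar> \<le> e"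
    using ucontD[OF phi e] by blast
  have "\<bar>birkhoff n phi w - birkhoff n phi w'\<bar> \<le> e * real n + 2 * B * (2 * real N)"
    if w: "\<And>i. i \<in> {0..<int n} \<Longrightarrow> w i = w' i" for n w w'
  proof -
    define Q where "Q = {..<N} \<union> {n - N..<n}"
    have "card Q \<le> N + N" unfolding Q_def by (rule order.trans[OF card_Un_le]) auto
    then have cQ: "real (card Q) \<le> 2 * real N" by linarith
    have fQ: "finite Q" by (simp add: Q_def)
    have summand: "\<bar>phi (shiftp (int k) w) - phi (shiftp (int k) w')\<bar> \<le> e + (if k \<in> Q then 2 * B else 0)" if k: "k < n" for k
    proof (cases "k \<in> Q")
      case True
      then show ?thesis using B(2)[of "shiftp (int k) w"] B(2)[of "shiftp (int k) w'"] e by (simp add: abs_le_iff)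
    next
      case False
      then have "agree N (shiftp (int k) w) (shiftp (int k) w')"
        using k by (auto simp: agree_def shiftp_def Q_def intro!: w)
      then show ?thesis using N False by simp
    qed
    have "\<bar>birkhoff n phi w - birkhoff n phi w'\<bar> \<le> (\<Sum>k<n. \<bar>phi (shiftp (int k) w) - phi (shiftp (int k) w')\<bar>)"
      by (simp add: birkhoff_def funpow_shift sum_subtractf[symmetric])
    also have "\<dots> \<le> (\<Sum>k<n. e + (if k \<in> Q then 2 * B else 0))" by (intro sum_mono summand) auto
    also have "\<dots> = e * real n + 2 * B * real (card ({..<n} \<inter> Q))"
      by (simp add: sum.distrib sum.If_cases)
    also have "\<dots> \<le> e * real n + 2 * B * (2 * real N)"
    proof -
      have "card ({..<n} \<inter> Q) \<le> card Q" by (rule card_mono[OF fQ]) auto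
      then have "real (card ({..<n} \<inter> Q)) \<le> 2 * real N" using cQ by linarith
      then show ?thesis using B(1) by (intro add_left_mono mult_left_mono) auto
    qed
    finally show ?thesis .
  qed
  then show ?thesis by blast
qed

section \<open>The Gibbsian specification\<close>

lemma glue_self: "x \<in> conf L w \<Longrightarrow> glue L x w = x"
  by (auto simp: conf_def glue_def)

lemma glue_in_conf: "glue L x w \<in> conf L w"
  by (auto simp: conf_def glue_def)

lemma self_in_conf: "w \<in> conf L w"
  by (auto simp: conf_def)

lemma conf_sym: "v \<in> conf L w \<longleftrightarrow> w \<in> conf L v"
  by (auto simp: conf_def)

lemma shiftp_in_conf_iff: "shiftp j z \<in> conf L (shiftp j w) \<longleftrightarrow> z \<in> conf ((\<lambda>i. i + j) ` L) w"
proof -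
  have "i \<in> (\<lambda>i. i + j) ` L \<longleftrightarrow> i - j \<in> L" for i by (auto simp: image_iff) (metis diff_add_cancel)
  then show ?thesis unfolding conf_def shiftp_def mem_Collect_eq
    by (metis add_diff_cancel_right' diff_add_cancel)
qed

lemma finite_diff_conf: "finite L \<Longrightarrow> z \<in> conf L w \<Longrightarrow> y \<in> conf L w \<Longrightarrow> finite {i. z i \<noteq> y i}"
  by (rule finite_subset[of _ L]) (auto simp: conf_def, metis)

lemma finite_conf:
  assumes "finite L" shows "finite (conf L (w :: int \<Rightarrow> 'e::finite))"
proof -
  have "finite (range (\<lambda>x. glue L x w))"
    by (rule finite_range_local[of L]) (use assms in \<open>auto simp: glue_def\<close>)
  moreover have "conf L w \<subseteq> range (\<lambda>x. glue L x w)" using glue_self by (metis rangeI subsetI)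
  ultimately show ?thesis by (rule finite_subset[rotated])
qed

lemma sum_conf_glue: "(\<Sum>z\<in>conf L w. h z) = (\<Sum>x\<in>conf L v. h (glue L x w))"
  by (rule sum.reindex_bij_witness[of _ "\<lambda>x. glue L x w" "\<lambda>x. glue L x v"])
     (auto simp: conf_def glue_def intro!: arg_cong[where f = h])

text \<open>The log-sum-exp function is 1-Lipschitz for the maximum norm, so uniform errors in
  energies pass to logarithms of partition functions without growing.\<close>

lemma abs_ln_sum_exp_diff_le:
  fixes a b :: "'a \<Rightarrow> real"
  assumes I: "finite I" "I \<noteq> {}" and d: "\<And>i. i \<in> I \<Longrightarrow> \<bar>a i - b i\<bar> \<le> D"
  shows "\<bar>ln (\<Sum>i\<in>I. exp (a i)) - ln (\<Sum>i\<in>I. exp (b i))\<bar> \<le> D"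
proof -
  have one: "ln (\<Sum>i\<in>I. exp (a i)) \<le> ln (\<Sum>i\<in>I. exp (b i)) + D"
    if d: "\<And>i. i \<in> I \<Longrightarrow> a i \<le> b i + D" for a b :: "'a \<Rightarrow> real"
  proof -
    have pos: "0 < (\<Sum>i\<in>I. exp (c i))" for c :: "'a \<Rightarrow> real" using I by (intro sum_pos) auto
    have "(\<Sum>i\<in>I. exp (a i)) \<le> (\<Sum>i\<in>I. exp (b i) * exp D)"
      by (intro sum_mono) (simp add: exp_add[symmetric] d)
    also have "\<dots> = (\<Sum>i\<in>I. exp (b i)) * exp D" by (simp add: sum_distrib_right)
    finally have "ln (\<Sum>i\<in>I. exp (a i)) \<le> ln ((\<Sum>i\<in>I. exp (b i)) * exp D)" using pos by simp
    also have "\<dots> = ln (\<Sum>i\<in>I. exp (b i)) + D" using pos[of b] by (simp add: ln_mult_pos)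
    finally show ?thesis .
  qed
  have "a i \<le> b i + D" "b i \<le> a i + D" if "i \<in> I" for i using d[OF that] by auto
  then show ?thesis using one[of a b] one[of b a] by (simp add: abs_le_iff algebra_simps)
qed

context ext_potential
begin

text \<open>The relative energy is measured from the evaluated configuration itself, so the
  numerator is exp 0 = 1. Using \<open>glue\<close> makes the value depend on x inside L and on w
  outside L by construction.\<close>

definition kernel :: "int set \<Rightarrow> (int \<Rightarrow> 'e) \<Rightarrow> (int \<Rightarrow> 'e) \<Rightarrow> real" where
  "kernel L x w = 1 / (\<Sum>z\<in>conf L w. exp (R z (glue L x w)))"

lemma partition_function_pos:
  assumes "finite L" shows "(\<Sum>z\<in>conf L w. exp (R z v)) > 0"
proof (rule sum_pos)
  show "conf L w \<noteq> {}" using self_in_conf by blast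
qed (auto simp: finite_conf assms)

lemma kernel_pos: "finite L \<Longrightarrow> kernel L x w > 0"
  unfolding kernel_def using partition_function_pos by simp

text \<open>The usual Boltzmann form with a free reference configuration v: by the cocycle identity
  a change of reference multiplies numerator and partition function by the same factor.\<close>

lemma kernel_conf:
  assumes L: "finite L" and x: "x \<in> conf L w" and v: "v \<in> conf L w"
  shows "kernel L x w = exp (R x v) / (\<Sum>z\<in>conf L w. exp (R z v))"
proof -
  have "(\<Sum>z\<in>conf L w. exp (R z x)) * exp (R x v) = (\<Sum>z\<in>conf L w. exp (R z v))"
    unfolding sum_distrib_right exp_add[symmetric]
    by (intro sum.cong refl) (use R_trans finite_diff_conf[OF L] x v in metis)
  then show ?thesis
    using partition_function_pos[OF L, of x w] partition_function_pos[OF L, of v w]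
    by (simp add: kernel_def glue_self[OF x] field_simps)
qed

lemma kernel_sum: "finite L \<Longrightarrow> (\<Sum>eta\<in>conf L w. kernel L eta w) = 1"
  using partition_function_pos[of L w w]
  by (simp add: kernel_conf[OF _ _ self_in_conf] sum_divide_distrib[symmetric])

lemma kernel_local:
  assumes "\<forall>i\<in>L. eta i = eta' i" "\<forall>i. i \<notin> L \<longrightarrow> w i = w' i"
  shows "kernel L eta w = kernel L eta' w'"
proof -
  have "conf L w = conf L w'" using assms(2) by (auto simp: conf_def)
  moreover have "glue L eta w = glue L eta' w'" using assms by (auto simp: glue_def)
  ultimately show ?thesis by (simp add: kernel_def)
qed

lemma kernel_conf_self: "x \<in> conf L w \<Longrightarrow> kernel L x w = kernel L x x"
  by (rule kernel_local) (auto simp: conf_def)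

text \<open>Agreement off D is symmetric, so the double sum may be taken over the inner
  configuration \<open>zeta\<close> first. For fixed \<open>zeta\<close> the weights of
  \<open>eta\<close> add up to the partition function of D, which cancels the denominator of the
  inner kernel.\<close>

lemma kernel_consistent:
  assumes L: "finite L" and D: "D \<subseteq> L"
  shows "(\<Sum>eta\<in>conf L w. kernel L eta w * spec_apply kernel D f eta) = spec_apply kernel L f w"
proof -
  have fD: "finite D" using L D finite_subset by blast
  have DL: "eta \<in> conf D zeta \<Longrightarrow> zeta \<in> conf L w \<Longrightarrow> eta \<in> conf L w" for eta zeta
    using D by (auto simp: conf_def)
  have "(\<Sum>eta\<in>conf L w. kernel L eta w * spec_apply kernel D f eta)
      = (\<Sum>eta\<in>conf L w. \<Sum>zeta\<in>conf D eta. kernel L eta w * kernel D zeta eta * f zeta)"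
    by (simp add: spec_apply_def sum_distrib_left mult.assoc)
  also have "\<dots> = (\<Sum>(eta, zeta)\<in>Sigma (conf L w) (conf D). kernel L eta w * kernel D zeta eta * f zeta)"
    by (rule sum.Sigma) (auto simp: finite_conf L fD)
  also have "\<dots> = (\<Sum>(zeta, eta)\<in>Sigma (conf L w) (conf D). kernel L eta w * kernel D zeta eta * f zeta)"
  proof (rule sum.reindex_bij_witness[of _ prod.swap prod.swap])
    have sw: "prod.swap p \<in> Sigma (conf L w) (conf D)" if "p \<in> Sigma (conf L w) (conf D)" for p
      using that DL[of "snd p" "fst p"] conf_sym[of "snd p" D "fst p"]
      by (cases p) (simp only: mem_Sigma_iff swap_simp fst_conv snd_conv)
    show "prod.swap p \<in> Sigma (conf L w) (conf D)" if "p \<in> Sigma (conf L w) (conf D)" for p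
      by (rule sw[OF that])
    show "prod.swap p \<in> Sigma (conf L w) (conf D)" if "p \<in> Sigma (conf L w) (conf D)" for p
      by (rule sw[OF that])
  qed (simp_all add: case_prod_unfold)
  also have "\<dots> = (\<Sum>zeta\<in>conf L w. \<Sum>eta\<in>conf D zeta. kernel L eta w * kernel D zeta eta * f zeta)"
    by (rule sum.Sigma[symmetric]) (auto simp: finite_conf L fD)
  also have "\<dots> = (\<Sum>zeta\<in>conf L w. kernel L zeta w * f zeta)"
  proof (rule sum.cong[OF refl])
    fix zeta assume z: "zeta \<in> conf L w"
    let ?Z = "\<Sum>z\<in>conf L w. exp (R z zeta)"
    let ?Y = "\<Sum>z\<in>conf D zeta. exp (R z zeta)"
    have "kernel L eta w * kernel D zeta eta = exp (R eta zeta) * (1 / (?Z * ?Y))" if e: "eta \<in> conf D zeta" for eta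
    proof -
      have "kernel D zeta eta = kernel D zeta zeta"
        by (rule kernel_local) (use e in \<open>auto simp: conf_def\<close>)
      also have "\<dots> = 1 / ?Y" by (simp add: kernel_def glue_self[OF self_in_conf])
      finally show ?thesis using kernel_conf[OF L DL[OF e z] z] by simp
    qed
    then have "(\<Sum>eta\<in>conf D zeta. kernel L eta w * kernel D zeta eta) = ?Y * (1 / (?Z * ?Y))"
      by (simp add: sum_divide_distrib)
    also have "\<dots> = 1 / ?Z" using partition_function_pos[OF fD, of zeta zeta] by simp
    also have "\<dots> = kernel L zeta w" by (simp add: kernel_def glue_self[OF z])
    finally show "(\<Sum>eta\<in>conf D zeta. kernel L eta w * kernel D zeta eta * f zeta) = kernel L zeta w * f zeta"
      by (simp add: sum_distrib_right[symmetric])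
  qed
  finally show ?thesis by (simp add: spec_apply_def)
qed

lemma ucont_kernel:
  assumes L: "finite L" shows "ucont (\<lambda>w. kernel L w w)"
proof -
  \<comment> \<open>Indexing the partition function by the patterns over one fixed outer
    configuration makes the index set independent of w, so it is a finite sum of continuous
    functions.\<close>
  have "kernel L w w = inverse (\<Sum>x\<in>conf L undefined. exp (R (glue L x w) w))" for w
    unfolding kernel_def glue_self[OF self_in_conf] inverse_eq_divide
    by (subst sum_conf_glue[of _ _ _ undefined]) simp
  moreover have "ucont (\<lambda>w. inverse (\<Sum>x\<in>conf L undefined. exp (R (glue L x w) w)))"
  proof (rule ucont_real_comp[where h = inverse and S = "{0<..}"])
    have "ucont (\<lambda>w. exp (R (glue L x w) w))" for x
      by (rule ucont_real_comp[OF ucont_R_glue[OF L], of UNIV]) (auto intro: continuous_intros)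
    then show "ucont (\<lambda>w. \<Sum>x\<in>conf L undefined. exp (R (glue L x w) w))" by (intro ucont_sum)
    show "range (\<lambda>w. \<Sum>x\<in>conf L undefined. exp (R (glue L x w) w)) \<subseteq> {0<..}"
      using finite_conf[OF L] self_in_conf by (auto intro!: sum_pos)
  qed (auto intro!: continuous_intros)
  ultimately show ?thesis by simp
qed

lemma ucont_spec_apply:
  assumes L: "finite L" and f: "ucont f"
  shows "ucont (spec_apply kernel L f)"
proof -
  have "spec_apply kernel L f w = (\<Sum>x\<in>conf L undefined. kernel L (glue L x w) (glue L x w) * f (glue L x w))" for w
    unfolding spec_apply_def
    by (subst sum_conf_glue[of _ _ _ undefined]) (simp add: kernel_conf_self[OF glue_in_conf])
  moreover have "ucont (\<lambda>w. \<Sum>x\<in>conf L undefined. kernel L (glue L x w) (glue L x w) * f (glue L x w))"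
    by (intro ucont_sum ucont_glue[of "\<lambda>w. kernel L w w * f w"] ucont_mult ucont_kernel L f)
  ultimately show ?thesis by presburger
qed

lemma spec_apply_mono:
  assumes "finite L" "\<And>w. f w \<le> h w" shows "spec_apply kernel L f w \<le> spec_apply kernel L h w"
  unfolding spec_apply_def
  by (intro sum_mono mult_left_mono assms less_imp_le[OF kernel_pos])

lemma spec_apply_add: "spec_apply kernel L (\<lambda>w. f w + h w) w = spec_apply kernel L f w + spec_apply kernel L h w"
  by (simp add: spec_apply_def sum.distrib algebra_simps)

lemma spec_apply_cmult: "spec_apply kernel L (\<lambda>w. c * f w) w = c * spec_apply kernel L f w"
  by (simp add: spec_apply_def sum_distrib_left algebra_simps)

lemma spec_apply_const: "finite L \<Longrightarrow> spec_apply kernel L (\<lambda>_. c) w = c"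
  by (simp add: spec_apply_def sum_distrib_right[symmetric] kernel_sum)

lemma spec_apply_pos:
  assumes "finite L" "\<And>w. f w > 0" shows "spec_apply kernel L f w > 0"
  unfolding spec_apply_def
proof (rule sum_pos)
  show "conf L w \<noteq> {}" using self_in_conf by blast
qed (auto simp: finite_conf assms kernel_pos)

lemma kernel_gibbsian: "gibbsian_specification kernel"
  unfolding gibbsian_specification_def is_specification_def
proof (intro conjI allI impI)
  fix L :: "int set" assume L: "finite L"
  show "kernel L eta w \<ge> 0" for eta w using kernel_pos[OF L] by (simp add: less_imp_le)
  show "kernel L eta w = kernel L eta' w'" if "\<forall>i\<in>L. eta i = eta' i" "\<forall>i. i \<notin> L \<longrightarrow> w i = w' i" for eta eta' w w'
    by (rule kernel_local[OF that])
  show "(\<Sum>eta\<in>conf L w. kernel L eta w) = 1" for w by (rule kernel_sum[OF L])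
  show "(\<Sum>eta\<in>conf L w. kernel L eta w * spec_apply kernel D f eta) = spec_apply kernel L f w"
    if "D \<subseteq> L" for D f w by (rule kernel_consistent[OF L that])
  show "0 < (INF w. kernel L w w)"
  proof -
    obtain w where "\<And>w'. kernel L w w \<le> kernel L w' w'" using ucont_attains_inf[OF ucont_kernel[OF L]] by blast
    then have "kernel L w w \<le> (INF w. kernel L w w)" by (intro cINF_greatest) auto
    then show ?thesis using kernel_pos[OF L, of w w] by linarith
  qed
  show "continuous_map Omega_top euclideanreal (\<lambda>w. kernel L w w)"
    by (simp add: continuous_map_iff_ucont ucont_kernel[OF L])
qed

lemma kernel_shiftp:
  assumes L: "finite L" and x: "x \<in> conf ((\<lambda>i. i + j) ` L) w"
  shows "kernel ((\<lambda>i. i + j) ` L) x w = kernel L (shiftp j x) (shiftp j w)"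
proof -
  let ?L = "(\<lambda>i. i + j) ` L"
  note iff = shiftp_in_conf_iff[of j _ L w]
  have fL: "finite ?L" using L by simp
  have "(\<Sum>z\<in>conf ?L w. exp (R z x)) = (\<Sum>z\<in>conf L (shiftp j w). exp (R z (shiftp j x)))"
  proof (rule sum.reindex_bij_witness[of _ "shiftp (- j)" "shiftp j"])
    fix z assume z: "z \<in> conf ?L w"
    show "exp (R (shiftp j z) (shiftp j x)) = exp (R z x)"
      using R_shiftp[OF finite_diff_conf[OF fL z x]] by simp
    show "shiftp j z \<in> conf L (shiftp j w)" using iff z by simp
  next
    fix z assume z: "z \<in> conf L (shiftp j w)"
    then show "shiftp (- j) z \<in> conf ?L w" using iff[of "shiftp (- j) z"] by simp
  qed auto
  moreover have "shiftp j x \<in> conf L (shiftp j w)" using iff x by simp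
  ultimately show ?thesis by (simp add: kernel_def glue_self x)
qed

text \<open>Stationarity of the specification, a consequence of \<open>R_shiftp\<close>; it lets one
  estimate near the origin serve all translated windows.\<close>

lemma spec_apply_shiftp:
  assumes L: "finite L"
  shows "spec_apply kernel ((\<lambda>i. i + j) ` L) (\<lambda>w. f (shiftp j w)) w = spec_apply kernel L f (shiftp j w)"
proof -
  let ?L = "(\<lambda>i. i + j) ` L"
  note iff = shiftp_in_conf_iff[of j _ L w]
  show ?thesis unfolding spec_apply_def
  proof (rule sum.reindex_bij_witness[of _ "shiftp (- j)" "shiftp j"])
    fix z assume z: "z \<in> conf L (shiftp j w)"
    then show "shiftp (- j) z \<in> conf ?L w" using iff[of "shiftp (- j) z"] by simp
  qed (use iff kernel_shiftp[OF L] in auto)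
qed

end

section \<open>Pressure and the kernel of an interval\<close>

definition words :: "nat \<Rightarrow> 'e list set" where
  "words n = {ws. length ws = n}"

lemma finite_words: "finite (words n :: 'e::finite list set)"
  using finite_lists_length_eq[of "UNIV :: 'e set" n] by (simp add: words_def)

lemma birkhoff_add: "birkhoff (m + n) phi w = birkhoff m phi w + birkhoff n phi (shiftp (int m) w)"
proof -
  have "birkhoff (m + n) phi w = (\<Sum>k<m. phi (shiftp (int k) w)) + (\<Sum>k=m..<m+n. phi (shiftp (int k) w))"
    by (simp add: birkhoff_def funpow_shift lessThan_atLeast0 sum.atLeastLessThan_concat)
  also have "(\<Sum>k=m..<m+n. phi (shiftp (int k) w)) = (\<Sum>k<n. phi (shiftp (int k) (shiftp (int m) w)))"
    by (rule sum.reindex_bij_witness[of _ "\<lambda>k. k + m" "\<lambda>k. k - m"]) (auto simp: of_nat_diff)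
  finally show ?thesis by (simp add: birkhoff_def funpow_shift)
qed

lemma abs_birkhoff_le:
  assumes "\<And>w. \<bar>phi w\<bar> \<le> B"
  shows "\<bar>birkhoff n phi w\<bar> \<le> B * real n"
proof -
  have "\<bar>birkhoff n phi w\<bar> \<le> (\<Sum>k<n. \<bar>phi ((shift ^^ k) w)\<bar>)" unfolding birkhoff_def by (rule sum_abs)
  also have "\<dots> \<le> (\<Sum>k<n. B)" by (intro sum_mono assms)
  finally show ?thesis by (simp add: mult.commute)
qed

definition word_sup :: "((int \<Rightarrow> 'e) \<Rightarrow> real) \<Rightarrow> 'e list \<Rightarrow> real" where
  "word_sup phi ws = (SUP w \<in> word_cyl ws. birkhoff (length ws) phi w)"

lemma word_cyl_nonempty: "word_cyl ws \<noteq> {}"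
proof -
  have "(\<lambda>i. ws ! nat i) \<in> word_cyl ws" by (simp add: word_cyl_def)
  then show ?thesis by blast
qed

text \<open>On the cylinder of a concatenation the Birkhoff sum splits, so the supremum is at most
  the sum of the two suprema and the logarithms are subadditive. Boundedness of phi gives the linear
  lower bound.\<close>

lemma top_pressure_limit:
  fixes phi :: "(int \<Rightarrow> 'e::finite) \<Rightarrow> real"
  assumes phi: "ucont phi"
  shows "(\<lambda>n. ln (\<Sum>ws\<in>words n. exp (word_sup phi ws)) / real n) \<longlonglongrightarrow> top_pressure phi"
proof -
  obtain B where B: "B \<ge> 0" "\<And>w. \<bar>phi w\<bar> \<le> B" using ucont_bounded[OF phi] by blast
  define a where "a = (\<lambda>n. ln (\<Sum>ws\<in>words n. exp (word_sup phi (ws :: 'e list))))"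
  have bdd: "bdd_above (birkhoff n phi ` A)" for n A
    by (rule bdd_aboveI2[of _ _ "B * real n"]) (use abs_birkhoff_le[of phi B n] B in \<open>auto simp: abs_le_iff\<close>)
  have ne: "words n \<noteq> {}" for n :: nat
    using length_replicate[of n undefined] unfolding words_def by blast
  have pos: "(\<Sum>ws\<in>words n. exp (word_sup phi (ws :: 'e list))) > 0" for n
    by (intro sum_pos finite_words ne) auto
  have up: "birkhoff (length ws) phi w \<le> word_sup phi ws" if "w \<in> word_cyl ws" for w ws
    unfolding word_sup_def by (rule cSUP_upper[OF that bdd])
  have split: "word_sup phi (us @ vs) \<le> word_sup phi us + word_sup phi vs" for us vs
    unfolding word_sup_def[of _ "us @ vs"]
  proof (rule cSUP_least[OF word_cyl_nonempty])
    fix w assume w: "w \<in> word_cyl (us @ vs)"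
    then have *: "w (int i) = (us @ vs) ! i" if "i < length us + length vs" for i
      using that by (simp add: word_cyl_def)
    have "w (int i) = us ! i" if "i < length us" for i
      using *[of i] that by (simp add: nth_append_left)
    then have "w \<in> word_cyl us" by (simp add: word_cyl_def)
    moreover have "w (int i + int (length us)) = vs ! i" if "i < length vs" for i
      using *[of "length us + i"] that by (simp add: nth_append_right add.commute)
    then have "shiftp (int (length us)) w \<in> word_cyl vs" by (simp add: word_cyl_def shiftp_def)
    ultimately show "birkhoff (length (us @ vs)) phi w \<le> word_sup phi us + word_sup phi vs"
      using up[of w us] up[of "shiftp (int (length us)) w" vs] by (simp add: birkhoff_add)
  qed
  have sub: "a (m + n) \<le> a m + a n" for m n
  proof -
    have "(\<Sum>ws\<in>words (m + n). exp (word_sup phi ws)) = (\<Sum>(us, vs)\<in>words m \<times> words n. exp (word_sup phi (us @ vs)))"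
      by (rule sum.reindex_bij_witness[of _ "\<lambda>(us, vs). us @ vs" "\<lambda>ws. (take m ws, drop m ws)"])
         (auto simp: words_def)
    also have "\<dots> \<le> (\<Sum>(us, vs)\<in>words m \<times> words n. exp (word_sup phi us) * exp (word_sup phi vs))"
      by (intro sum_mono) (auto simp: exp_add[symmetric] split)
    also have "\<dots> = (\<Sum>us\<in>words m. exp (word_sup phi us)) * (\<Sum>vs\<in>words n. exp (word_sup phi vs))"
      by (simp add: sum_product sum.cartesian_product)
    finally show ?thesis unfolding a_def using pos[of "m + n"] pos[of m] pos[of n]
      by (subst ln_mult_pos[symmetric]) (auto intro: ln_mono)
  qed
  have lb: "(- B) * real n \<le> a n" for n
  proof -
    obtain ws :: "'e list" where ws: "ws \<in> words n" using ne by blast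
    obtain w where w: "w \<in> word_cyl ws" using word_cyl_nonempty by blast
    have "- (B * real n) \<le> birkhoff n phi w" using abs_birkhoff_le[of phi B n w] B(2) by (simp add: abs_le_iff)
    also have "\<dots> \<le> word_sup phi ws" using up[OF w] ws by (simp add: words_def)
    finally have "exp (- (B * real n)) \<le> exp (word_sup phi ws)" by simp
    also have "\<dots> \<le> (\<Sum>ws\<in>words n. exp (word_sup phi ws))"
      by (rule member_le_sum[OF ws]) (auto simp: finite_words)
    finally show ?thesis unfolding a_def using pos[of n] by (simp add: ln_ge_iff)
  qed
  have "convergent (\<lambda>n. a n / real n)" by (rule fekete[OF sub lb])
  moreover have "top_pressure phi = lim (\<lambda>n. a n / real n)"
    unfolding top_pressure_def a_def words_def word_sup_def
    by (intro arg_cong[where f = lim] ext arg_cong[where f = "\<lambda>x. ln x / _"] sum.cong) auto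
  ultimately show ?thesis by (simp add: convergent_LIMSEQ_iff a_def)
qed

text \<open>C absorbs the finitely many n at which the quotient is not yet within e of its
  limit.\<close>

lemma limit_ratio_bound:
  fixes a :: "nat \<Rightarrow> real"
  assumes lim: "(\<lambda>n. a n / real n) \<longlonglongrightarrow> P" and e: "e > 0"
  shows "\<exists>C. \<forall>n. \<bar>a n - real n * P\<bar> \<le> e * real n + C"
proof -
  obtain N where N: "\<And>n. n \<ge> N \<Longrightarrow> norm (a n / real n - P) < e" using LIMSEQ_D[OF lim e] by blast
  define C where "C = (\<Sum>n\<le>N. \<bar>a n - real n * P\<bar>)"
  have C0: "C \<ge> 0" by (simp add: C_def sum_nonneg)
  have "\<bar>a n - real n * P\<bar> \<le> e * real n + C" for n
  proof (cases "n \<le> N")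
    case True
    then have "\<bar>a n - real n * P\<bar> \<le> C" unfolding C_def by (intro member_le_sum) auto
    then show ?thesis using e by (simp add: add_increasing)
  next
    case False
    then have n: "real n > 0" by simp
    have "a n - real n * P = real n * (a n / real n - P)" using n by (simp add: field_simps)
    then have "\<bar>a n - real n * P\<bar> = real n * \<bar>a n / real n - P\<bar>" by (simp add: abs_mult)
    also have "\<dots> \<le> real n * e" using N[of n] False n by (intro mult_left_mono) auto
    finally show ?thesis using C0 by (simp add: mult.commute)
  qed
  then show ?thesis by blast
qed

context ext_potential
begin

text \<open>Minus the logarithm of the kernel is the logarithm of a partition function. Three errors
  of rate e/3 arise: relative energies become differences of Birkhoff sums, the boundary condition w
  gives way to suprema over cylinders, and the word sum is replaced by n times the pressure.\<close>

lemma kernel_birkhoff_bound: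
  assumes e: "e > 0"
  shows "\<exists>C. \<forall>n w. \<bar>ln (kernel {0..<int n} w w) - (birkhoff n phi w - real n * top_pressure phi)\<bar> \<le> e * real n + C"
proof -
  have e3: "e / 3 > 0" using e by simp
  obtain C1 where C1: "\<And>n z y. (\<And>i. i \<notin> {0..<int n} \<Longrightarrow> z i = y i)
     \<Longrightarrow> \<bar>R z y - (birkhoff n phi z - birkhoff n phi y)\<bar> \<le> (e/3) * real n + C1"
    using R_birkhoff_bound[OF e3] by blast
  obtain C2 where C2: "\<And>n w w'. (\<And>i. i \<in> {0..<int n} \<Longrightarrow> w i = w' i)
     \<Longrightarrow> \<bar>birkhoff n phi w - birkhoff n phi w'\<bar> \<le> (e/3) * real n + C2"
    using birkhoff_local_bound[OF ucont_phi e3] by blast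
  obtain C3 where C3: "\<And>n. \<bar>ln (\<Sum>ws\<in>words n. exp (word_sup phi ws)) - real n * top_pressure phi\<bar> \<le> (e/3) * real n + C3"
    using limit_ratio_bound[OF top_pressure_limit[OF ucont_phi] e3] by blast
  have "\<bar>ln (kernel {0..<int n} w w) - (birkhoff n phi w - real n * top_pressure phi)\<bar> \<le> e * real n + (C1 + C2 + C3)" for n w
  proof -
    let ?L = "{0..<int n}"
    let ?g = "\<lambda>ws. glue ?L (\<lambda>i. ws ! nat i) w"
    have ne: "conf ?L w \<noteq> {}" using self_in_conf by blast
    have fin: "finite (conf ?L w)" by (simp add: finite_conf)
    have k: "ln (kernel ?L w w) = - ln (\<Sum>z\<in>conf ?L w. exp (R z w))"
      unfolding kernel_def glue_self[OF self_in_conf]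
      using partition_function_pos[of ?L w w] by (simp add: ln_div)
    have 1: "\<bar>ln (\<Sum>z\<in>conf ?L w. exp (R z w)) - ln (\<Sum>z\<in>conf ?L w. exp (birkhoff n phi z - birkhoff n phi w))\<bar>
        \<le> (e/3) * real n + C1"
      by (rule abs_ln_sum_exp_diff_le[OF fin ne]) (rule C1, simp add: conf_def)
    have pos: "(\<Sum>z\<in>conf ?L w. exp (birkhoff n phi z)) > 0" by (intro sum_pos fin ne) auto
    have 2: "ln (\<Sum>z\<in>conf ?L w. exp (birkhoff n phi z - birkhoff n phi w))
        = ln (\<Sum>z\<in>conf ?L w. exp (birkhoff n phi z)) - birkhoff n phi w"
      using pos by (simp add: exp_diff sum_divide_distrib[symmetric] ln_div)
    have bij: "(\<Sum>z\<in>conf ?L w. exp (birkhoff n phi z)) = (\<Sum>ws\<in>words n. exp (birkhoff n phi (?g ws)))"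
    proof (rule sum.reindex_bij_witness[of _ ?g "\<lambda>z. map (\<lambda>i. z (int i)) [0..<n]"])
      fix z assume z: "z \<in> conf ?L w"
      show zz: "?g (map (\<lambda>i. z (int i)) [0..<n]) = z"
        by (rule ext) (use z in \<open>simp add: glue_def conf_def nat_less_iff\<close>)
      show "map (\<lambda>i. z (int i)) [0..<n] \<in> words n" by (simp add: words_def)
      show "exp (birkhoff n phi (?g (map (\<lambda>i. z (int i)) [0..<n]))) = exp (birkhoff n phi z)" by (simp only: zz)
    next
      fix ws :: "'e list" assume ws: "ws \<in> words n"
      show "map (\<lambda>i. ?g ws (int i)) [0..<n] = ws"
        using ws by (intro nth_equalityI) (auto simp: words_def glue_def)
      show "?g ws \<in> conf ?L w" by (rule glue_in_conf)
    qed
    have 3: "\<bar>ln (\<Sum>ws\<in>words n. exp (birkhoff n phi (?g ws))) - ln (\<Sum>ws\<in>words n. exp (word_sup phi ws))\<bar> \<le> (e/3) * real n + C2"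
    proof (rule abs_ln_sum_exp_diff_le[OF finite_words])
      show "(words n :: 'e list set) \<noteq> {}" using length_replicate[of n undefined] unfolding words_def by blast
      fix ws :: "'e list" assume "ws \<in> words n"
      then have len: "length ws = n" by (simp add: words_def)
      have g: "?g ws \<in> word_cyl ws" by (auto simp: word_cyl_def glue_def len)
      have close: "\<bar>birkhoff n phi v - birkhoff n phi (?g ws)\<bar> \<le> (e/3) * real n + C2" if v: "v \<in> word_cyl ws" for v
      proof (rule C2)
        fix i assume "i \<in> {0..<int n}"
        then obtain k where "i = int k" "k < n" by (metis atLeastLessThan_iff of_nat_less_iff zero_le_imp_eq_int)
        then show "v i = ?g ws i" using v by (simp add: word_cyl_def len glue_def)
      qed
      have bdd: "bdd_above ((\<lambda>w. birkhoff n phi w) ` word_cyl ws)"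
        by (rule bdd_aboveI2[of _ _ "birkhoff n phi (?g ws) + ((e/3) * real n + C2)"])
           (use close in \<open>force simp: abs_le_iff\<close>)
      have "birkhoff n phi (?g ws) \<le> word_sup phi ws"
        unfolding word_sup_def len by (rule cSUP_upper[OF g bdd])
      moreover have "word_sup phi ws \<le> birkhoff n phi (?g ws) + ((e/3) * real n + C2)"
        unfolding word_sup_def len
        by (rule cSUP_least[OF word_cyl_nonempty]) (use close in \<open>force simp: abs_le_iff\<close>)
      ultimately show "\<bar>birkhoff n phi (?g ws) - word_sup phi ws\<bar> \<le> (e/3) * real n + C2" by linarith
    qed
    have "e * real n = 3 * ((e/3) * real n)" by simp
    then show ?thesis using 1[unfolded 2 bij] 3 C3[of n] unfolding k by (simp only: abs_le_iff) linarith
  qed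
  then show ?thesis by blast
qed

end

section \<open>Kolmogorov--Sinai entropy and block entropies\<close>

lemma measurable_count_spaceI:
  fixes f :: "'a \<Rightarrow> 'b::countable"
  assumes "\<And>y. f -` {y} \<inter> space M \<in> sets M"
  shows "f \<in> measurable M (count_space UNIV)"
proof (rule measurableI)
  fix A
  have "f -` A \<inter> space M = (\<Union>y\<in>A. f -` {y} \<inter> space M)" by auto
  also have "\<dots> \<in> sets M" using assms by (intro sets.countable_UN') auto
  finally show "f -` A \<inter> space M \<in> sets M" .
qed simp

lemma measurable_pair_count_space:
  fixes f :: "'a \<Rightarrow> 'b::countable" and g :: "'a \<Rightarrow> 'c::countable"
  assumes f: "f \<in> measurable M (count_space UNIV)" and g: "g \<in> measurable M (count_space UNIV)"
  shows "(\<lambda>w. (f w, g w)) \<in> measurable M (count_space UNIV)"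
proof (rule measurable_count_spaceI)
  fix y :: "'b \<times> 'c"
  have "(\<lambda>w. (f w, g w)) -` {y} \<inter> space M = (f -` {fst y} \<inter> space M) \<inter> (g -` {snd y} \<inter> space M)" by auto
  also have "\<dots> \<in> sets M" using measurable_sets[OF f, of "{fst y}"] measurable_sets[OF g, of "{snd y}"] by auto
  finally show "(\<lambda>w. (f w, g w)) -` {y} \<inter> space M \<in> sets M" .
qed

section \<open>Itineraries and their entropies\<close>

definition itin :: "((int \<Rightarrow> 'e) \<Rightarrow> 'b) \<Rightarrow> nat \<Rightarrow> (int \<Rightarrow> 'e) \<Rightarrow> 'b list" where
  "itin xi n w = map (\<lambda>k. xi (shiftp (int k) w)) [0..<n]"

lemma length_itin [simp]: "length (itin xi n w) = n"
  by (simp add: itin_def)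

lemma itin_nth: "k < n \<Longrightarrow> itin xi n w ! k = xi (shiftp (int k) w)"
  by (simp add: itin_def)

lemma itin_add: "itin xi (m + n) w = itin xi m w @ itin xi n (shiftp (int m) w)"
  by (rule nth_equalityI) (auto simp: itin_nth nth_append of_nat_diff)

lemma finite_range_itin:
  assumes "finite (range xi)" shows "finite (range (itin xi n))"
proof (rule finite_subset)
  show "range (itin xi n) \<subseteq> {us. set us \<subseteq> range xi \<and> length us = n}" by (auto simp: itin_def)
  show "finite {us. set us \<subseteq> range xi \<and> length us = n}" by (rule finite_lists_length_eq[OF assms])
qed

locale invariant_measure =
  fixes mu :: "(int \<Rightarrow> 'e::finite) measure"
  assumes inv: "invariant_prob mu"
begin

sublocale prob_space mu
  using inv by (simp add: invariant_prob_def)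

lemma space_mu [simp]: "space mu = UNIV" and sets_mu: "sets mu = sets Omega_borel"
  using inv by (auto simp: invariant_prob_def)

lemma measurable_mu: "measurable mu N = measurable Omega_borel N"
  by (rule measurable_cong_sets[OF sets_mu refl])

lemma shiftp_measurable_distr:
  "shiftp (int k) \<in> measurable mu mu \<and> distr mu mu (shiftp (int k)) = mu"
proof (induction k)
  case 0
  have "(shiftp 0 :: (int \<Rightarrow> 'e) \<Rightarrow> _) = (\<lambda>w. w)" by auto
  then show ?case by (simp add: distr_id)
next
  case (Suc k)
  have s: "shift \<in> measurable mu mu" "distr mu mu shift = mu" using inv by (auto simp: invariant_prob_def)
  have eq: "(shiftp (int (Suc k)) :: (int \<Rightarrow> 'e) \<Rightarrow> _) = shift \<circ> shiftp (int k)"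
    by (auto simp: fun_eq_iff shiftp_def shift_def algebra_simps)
  show ?case unfolding eq using Suc s distr_distr[of shift mu mu "shiftp (int k)" mu]
    by (auto intro: measurable_comp simp: o_def)
qed

lemma integral_shiftp:
  fixes f :: "(int \<Rightarrow> 'e) \<Rightarrow> real"
  assumes "f \<in> borel_measurable mu"
  shows "integral\<^sup>L mu (\<lambda>w. f (shiftp (int k) w)) = integral\<^sup>L mu f"
  using integral_distr[of "shiftp (int k)" mu mu f] shiftp_measurable_distr[of k] assms by simp

lemma itin_measurable:
  fixes xi :: "_ \<Rightarrow> 'b::countable"
  assumes xi: "xi \<in> measurable mu (count_space UNIV)"
  shows "itin xi n \<in> measurable mu (count_space UNIV)"
proof (induction n)
  case 0
  show ?case by (simp add: itin_def)
next
  case (Suc n)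
  have "(\<lambda>w. xi (shiftp (int n) w)) \<in> measurable mu (count_space UNIV)"
    using shiftp_measurable_distr[of n] xi by (auto intro: measurable_compose)
  from measurable_pair_count_space[OF Suc this]
  have "(\<lambda>w. (\<lambda>(us, u). us @ [u]) (itin xi n w, xi (shiftp (int n) w))) \<in> measurable mu (count_space UNIV)"
    by (rule measurable_compose) simp
  then show ?case by (simp add: itin_def)
qed

lemma part_entropy_itin_subadditive:
  fixes xi :: "_ \<Rightarrow> 'b::countable"
  assumes xi: "xi \<in> measurable mu (count_space UNIV)" and fin: "finite (range xi)"
  shows "part_entropy mu (itin xi (m + n)) \<le> part_entropy mu (itin xi m) + part_entropy mu (itin xi n)"
proof -
  have S: "shiftp (int m) \<in> measurable mu mu" "distr mu mu (shiftp (int m)) = mu"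
    using shiftp_measurable_distr by auto
  let ?f = "itin xi m" and ?g = "\<lambda>w. itin xi n (shiftp (int m) w)"
  have f: "?f \<in> measurable mu (count_space UNIV)" by (rule itin_measurable[OF xi])
  have g: "?g \<in> measurable mu (count_space UNIV)"
    using S(1) itin_measurable[OF xi] by (rule measurable_compose)
  have ff: "finite (?f ` space mu)" using finite_range_itin[OF fin] by simp
  have fg: "finite (?g ` space mu)"
    by (rule finite_subset[OF _ finite_range_itin[OF fin, of n]]) auto
  have fgm: "(\<lambda>w. (?f w, ?g w)) \<in> measurable mu (count_space UNIV)"
    by (rule measurable_pair_count_space[OF f g])
  have ffg: "finite ((\<lambda>w. (?f w, ?g w)) ` space mu)"
    by (rule finite_subset[OF _ finite_cartesian_product[OF ff fg]]) auto
  have "part_entropy mu (itin xi (m + n)) = part_entropy mu (\<lambda>w. (\<lambda>(a, b). a @ b) (?f w, ?g w))"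
    by (simp add: itin_add[abs_def])
  also have "\<dots> \<le> part_entropy mu (\<lambda>w. (?f w, ?g w))" by (rule part_entropy_comp_le[OF fgm ffg])
  also have "\<dots> \<le> part_entropy mu ?f + part_entropy mu ?g" by (rule part_entropy_pair_le[OF f ff g fg fgm])
  also have "part_entropy mu ?g = part_entropy mu (itin xi n)"
    by (rule part_entropy_distr[OF S itin_measurable[OF xi]]) (use finite_range_itin[OF fin] in simp)
  finally show ?thesis .
qed

lemma part_entropy_itin_le:
  fixes xi :: "_ \<Rightarrow> 'b::countable"
  assumes xi: "xi \<in> measurable mu (count_space UNIV)" and fin: "finite (range xi)"
  shows "part_entropy mu (itin xi n) \<le> real n * part_entropy mu xi"
proof (induction n)
  case 0
  have "itin xi 0 ` UNIV = {[]}" "\<And>w. itin xi 0 w = []" by (auto simp: itin_def)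
  then show ?case using prob_space by (simp add: part_entropy_def vimage_def)
next
  case (Suc n)
  have "part_entropy mu (itin xi 1) = part_entropy mu (\<lambda>w. [xi w])" by (simp add: itin_def[abs_def])
  also have "\<dots> \<le> part_entropy mu xi" by (rule part_entropy_comp_le[OF xi]) (use fin in simp)
  finally show ?case
    using Suc part_entropy_itin_subadditive[OF xi fin, of 1 n] by (simp add: algebra_simps)
qed

text \<open>Cross entropy against the distribution with mass 1 - s = exp (- e/2) at 0 and s / k at
  each other value. The value 0 costs e/2, any other costs ln (k / s), and d limits the mean of the
  latter to e/2. Taking k as the cardinality plus 1 also covers empty A. Coding values by
  \<open>Suc\<close> reserves 0 for "no correction".\<close>

lemma part_entropy_small:
  assumes K: "finite A" and e: "e > 0"
  shows "\<exists>d>0. \<forall>D. D \<in> measurable mu (count_space UNIV) \<longrightarrow> range D \<subseteq> insert 0 (Suc ` A)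
      \<longrightarrow> measure mu {w. D w \<noteq> 0} \<le> d \<longrightarrow> part_entropy mu D \<le> e"
proof -
  define k where "k = real (card A) + 1"
  define s where "s = 1 - exp (- e/2)"
  have s: "0 < s" "s < 1" using e by (auto simp: s_def)
  have k: "k \<ge> 1" by (simp add: k_def)
  have "k / s > 1" using s k by (simp add: field_simps)
  then have l: "ln (k / s) > 0" by simp
  define d where "d = (e/2) / ln (k / s)"
  have d: "d > 0" using e l by (simp add: d_def)
  have "part_entropy mu D \<le> e" if D: "D \<in> measurable mu (count_space UNIV)"
    and r: "range D \<subseteq> insert 0 (Suc ` A)" and m: "measure mu {w. D w \<noteq> 0} \<le> d" for D :: "_ \<Rightarrow> nat"
  proof -
    define q where "q = (\<lambda>i::nat. if i = 0 then 1 - s else s / k)"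
    have fin: "finite (D ` space mu)" using r K by (simp add: finite_subset)
    have "(\<Sum>y\<in>D ` space mu. q y) \<le> (\<Sum>y\<in>insert 0 (Suc ` A). q y)"
      by (rule sum_mono2) (use r K s k in \<open>auto simp: q_def\<close>)
    also have "\<dots> = (1 - s) + (\<Sum>y\<in>Suc ` A. q y)"
      using K by (subst sum.insert) (auto simp: q_def)
    also have "(\<Sum>y\<in>Suc ` A. q y) = real (card A) * (s / k)"
      by (subst sum.reindex) (auto simp: q_def)
    also have "\<dots> \<le> s" using s by (simp add: k_def field_simps)
    finally have sum: "(\<Sum>y\<in>D ` space mu. q y) \<le> 1" by simp
    have "part_entropy mu D \<le> - integral\<^sup>L mu (\<lambda>w. ln (q (D w)))"
      by (rule part_entropy_le_cross_entropy[OF D fin _ _ sum]) (use s k in \<open>auto simp: q_def\<close>)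
    also have "\<dots> = integral\<^sup>L mu (\<lambda>w. - ln (q (D w)))" by simp
    also have "\<dots> \<le> integral\<^sup>L mu (\<lambda>w. e/2 + (if D w = 0 then 0 else ln (k / s)))"
    proof (rule integral_mono)
      show "integrable mu (\<lambda>w. - ln (q (D w)))" by (rule integral_finite_valued(1)[OF D fin, of "\<lambda>y. - ln (q y)"])
      show "integrable mu (\<lambda>w. e/2 + (if D w = 0 then 0 else ln (k / s)))"
        by (rule integral_finite_valued(1)[OF D fin, of "\<lambda>y. e/2 + (if y = 0 then 0 else ln (k / s))"])
      show "- ln (q (D w)) \<le> e/2 + (if D w = 0 then 0 else ln (k / s))" for w
        using s k e by (auto simp: q_def s_def ln_div)
    qed
    also have "\<dots> = e/2 + ln (k / s) * measure mu {w. D w \<noteq> 0}"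
    proof -
      have ms: "{w. D w \<noteq> 0} \<in> sets mu" using measurable_sets[OF D, of "- {0}"] by (simp add: vimage_def Compl_eq)
      have eq: "(\<lambda>w. e/2 + (if D w = 0 then 0 else ln (k / s))) = (\<lambda>w. e/2 + indicator {w. D w \<noteq> 0} w * ln (k / s))"
        by (auto simp: indicator_def)
      have "integrable mu (\<lambda>w. indicator {w. D w \<noteq> 0} w * ln (k / s) :: real)"
        using ms by (auto simp: emeasure_eq_measure)
      then show ?thesis unfolding eq using ms prob_space by simp
    qed
    also have "\<dots> \<le> e/2 + ln (k / s) * d" using l m by (intro add_left_mono mult_left_mono) auto
    also have "\<dots> = e" using l by (simp add: d_def)
    finally show ?thesis .
  qed
  then show ?thesis using d by blast
qed

text \<open>
  The partition xi is recovered from a local approximation g and a correction D that is rarely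
  nonzero: g is read off a longer word, and D has small entropy.
\<close>

lemma ks_entropy_part_le:
  assumes xi: "xi \<in> measurable mu (count_space UNIV)" and fin: "finite (range xi)" and p: "p > 0"
  shows "ks_entropy_part mu xi \<le> part_entropy mu (itin (\<lambda>w. w 0) p) / real p"
proof -
  let ?a = "\<lambda>n. part_entropy mu (itin (\<lambda>w :: int \<Rightarrow> 'e. w 0) n)"
  let ?b = "\<lambda>n. part_entropy mu (itin xi n)"
  have co: "(\<lambda>w :: int \<Rightarrow> 'e. w 0) \<in> measurable mu (count_space UNIV)"
    unfolding measurable_mu by (rule local_measurable[of 0]) (simp add: agree_def)
  have fco: "finite (range (\<lambda>w :: int \<Rightarrow> 'e. w 0))" by simp
  have ks: "ks_entropy_part mu xi = lim (\<lambda>n. ?b n / real n)"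
    by (simp add: ks_entropy_part_def itin_def[abs_def] funpow_shift)
  have "convergent (\<lambda>n. ?b n / real n)"
    by (rule fekete[OF part_entropy_itin_subadditive[OF xi fin], of 0]) (simp add: part_entropy_nonneg)
  then have lim: "(\<lambda>n. ?b n / real n) \<longlonglongrightarrow> ks_entropy_part mu xi" by (simp add: ks convergent_LIMSEQ_iff)
  obtain B where B: "\<And>n. ?a n \<le> real n * (?a p / real p) + B"
    using subadditive_affine_bound[OF part_entropy_itin_subadditive[OF co fco] p] by blast
  have "ks_entropy_part mu xi \<le> ?a p / real p + e" if e: "e > 0" for e
  proof -
    obtain d where d: "d > 0" "\<And>D. D \<in> measurable mu (count_space UNIV) \<Longrightarrow> range D \<subseteq> insert 0 (Suc ` range xi)
      \<Longrightarrow> measure mu {w. D w \<noteq> 0} \<le> d \<Longrightarrow> part_entropy mu D \<le> e"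
      using part_entropy_small[OF fin e] by blast
    obtain N g where g: "\<And>w w'. agree N w w' \<Longrightarrow> g w = g w'" "range g \<subseteq> range xi"
      "measure mu {w. xi w \<noteq> g w} \<le> d"
      using partition_approximable[OF prob_space_axioms sets_mu xi fin d(1)] by blast
    \<comment> \<open>D records the true value where the approximation fails, so \<open>xi\<close>
      is read from g where D is 0 and from D - 1 elsewhere.\<close>
    define D where "D = (\<lambda>w. if xi w = g w then 0 else Suc (xi w))"
    have gm: "g \<in> measurable mu (count_space UNIV)"
      unfolding measurable_mu by (rule local_measurable[of N]) (rule g(1))
    have fg: "finite (range g)" using g(2) fin finite_subset by blast
    have "(\<lambda>w. (\<lambda>(x, y). if x = y then 0 else Suc x) (xi w, g w)) \<in> measurable mu (count_space UNIV)"
      by (rule measurable_compose[OF measurable_pair_count_space[OF xi gm]]) simp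
    then have Dm: "D \<in> measurable mu (count_space UNIV)" by (simp add: D_def)
    have Dr: "range D \<subseteq> insert 0 (Suc ` range xi)" by (auto simp: D_def)
    then have fD: "finite (range D)" using fin finite_subset by blast
    have "{w. D w \<noteq> 0} = {w. xi w \<noteq> g w}" by (auto simp: D_def)
    then have HD: "part_entropy mu D \<le> e" using d(2)[OF Dm Dr] g(3) by simp
    have step: "?b n \<le> ?a (n + 2 * N) + real n * e" for n
    proof -
      have gD: "(\<lambda>w. (itin g n w, itin D n w)) \<in> measurable mu (count_space UNIV)"
        by (intro measurable_pair_count_space itin_measurable gm Dm)
      have fg': "finite (itin g n ` space mu)" "finite (itin D n ` space mu)"
        using finite_range_itin[OF fg] finite_range_itin[OF fD] by auto
      have fgD: "finite ((\<lambda>w. (itin g n w, itin D n w)) ` space mu)"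
        by (rule finite_subset[OF _ finite_cartesian_product[OF fg']]) auto
      have "itin xi n w = (\<lambda>(us, vs). map2 (\<lambda>u v. if v = 0 then u else v - 1) us vs) (itin g n w, itin D n w)" for w
        by (rule nth_equalityI) (auto simp: itin_nth D_def)
      then have "?b n = part_entropy mu (\<lambda>w. (\<lambda>(us, vs). map2 (\<lambda>u v. if v = 0 then u else v - 1) us vs) (itin g n w, itin D n w))"
        by presburger
      also have "\<dots> \<le> part_entropy mu (\<lambda>w. (itin g n w, itin D n w))" by (rule part_entropy_comp_le[OF gD fgD])
      also have "\<dots> \<le> part_entropy mu (itin g n) + part_entropy mu (itin D n)"
        by (rule part_entropy_pair_le[OF itin_measurable[OF gm] fg'(1) itin_measurable[OF Dm] fg'(2) gD])
      also have "part_entropy mu (itin D n) \<le> real n * part_entropy mu D" by (rule part_entropy_itin_le[OF Dm fD])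
      also have "\<dots> \<le> real n * e" using HD by (intro mult_left_mono) auto
      \<comment> \<open>The windows of g reach N sites to the left of 0. Shifting by N, which
        invariance allows, moves them all into [0, n + 2 N), where the word of that length
        determines them.\<close>
      also have "part_entropy mu (itin g n) = part_entropy mu (\<lambda>w. itin g n (shiftp (int N) w))"
        by (rule part_entropy_distr[symmetric]) (use shiftp_measurable_distr[of N] itin_measurable[OF gm] fg'(1) in auto)
      also have "\<dots> = part_entropy mu (\<lambda>w. (\<lambda>us. map (\<lambda>k. g (\<lambda>i. us ! nat (i + int N + int k))) [0..<n]) (itin (\<lambda>w. w 0) (n + 2 * N) w))"
      proof -
        have "itin g n (shiftp (int N) w) = map (\<lambda>k. g (\<lambda>i. itin (\<lambda>w. w 0) (n + 2 * N) w ! nat (i + int N + int k))) [0..<n]" for w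
        proof (rule nth_equalityI)
          fix k assume "k < length (itin g n (shiftp (int N) w))"
          then have k: "k < n" by simp
          have "g (shiftp (int k) (shiftp (int N) w)) = g (\<lambda>i. itin (\<lambda>w. w 0) (n + 2 * N) w ! nat (i + int N + int k))"
          proof (rule g(1), unfold agree_def, intro allI impI)
            fix i assume "\<bar>i\<bar> \<le> int N"
            then have "nat (i + int N + int k) < n + 2 * N" "i + int N + int k \<ge> 0" using k by linarith+
            then show "shiftp (int k) (shiftp (int N) w) i = itin (\<lambda>w. w 0) (n + 2 * N) w ! nat (i + int N + int k)"
              by (simp add: itin_nth shiftp_def algebra_simps)
          qed
          then show "itin g n (shiftp (int N) w) ! k = map (\<lambda>k. g (\<lambda>i. itin (\<lambda>w. w 0) (n + 2 * N) w ! nat (i + int N + int k))) [0..<n] ! k"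
            using k by (simp add: itin_nth)
        qed simp
        then show ?thesis by presburger
      qed
      also have "\<dots> \<le> ?a (n + 2 * N)"
        by (rule part_entropy_comp_le[OF itin_measurable[OF co]]) (use finite_range_itin[OF fco] in simp)
      finally show ?thesis by simp
    qed
    define c where "c = ?a p / real p"
    have "?b n / real n \<le> c + e + (2 * real N * c + B) / real n" if n: "n \<ge> 1" for n
    proof -
      have "?b n \<le> real (n + 2 * N) * c + B + real n * e" using step[of n] B[of "n + 2 * N"] by (simp add: c_def)
      then show ?thesis using n by (simp add: field_simps)
    qed
    moreover have "(\<lambda>n. c + e + (2 * real N * c + B) / real n) \<longlonglongrightarrow> c + e + 0"
      by (intro tendsto_add tendsto_const lim_const_over_n)
    ultimately have "ks_entropy_part mu xi \<le> c + e + 0"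
      by (intro LIMSEQ_le[OF lim]) auto
    then show ?thesis by (simp add: c_def)
  qed
  then show ?thesis by (rule field_le_epsilon)
qed

text \<open>The coordinate partition is a generator, so block entropies of words dominate the
  entropy of every finite partition. The bound at each finite length p is what the cross-entropy
  estimate can be compared with.\<close>

lemma ks_entropy_le:
  assumes p: "p > 0"
  shows "ks_entropy mu \<le> part_entropy mu (itin (\<lambda>w. w 0) p) / real p"
  unfolding ks_entropy_def
proof (rule cSUP_least)
  have "(\<lambda>_. 0) \<in> {xi. xi \<in> measurable mu (count_space UNIV) \<and> finite (range xi)}" by auto
  then show "{xi. xi \<in> measurable mu (count_space UNIV) \<and> finite (range xi)} \<noteq> ({} :: ((int \<Rightarrow> 'e) \<Rightarrow> nat) set)" by blast
qed (use ks_entropy_part_le[OF _ _ p] in auto)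

end

section \<open>The DLR equations\<close>

lemma exp_le_quadratic:
  fixes x :: real assumes "\<bar>x\<bar> \<le> 1" shows "exp x \<le> 1 + x + x\<^sup>2"
proof (cases "x \<ge> 0")
  case True
  then show ?thesis using exp_bound[of x] assms by simp
next
  case False
  define y where "y = - x"
  have y: "y > 0" using False by (simp add: y_def)
  have "exp x = 1 / exp y" by (simp add: y_def exp_minus inverse_eq_divide)
  also have "\<dots> \<le> 1 / (1 + y)" using y exp_ge_add_one_self[of y] by (intro divide_left_mono) auto
  also have "\<dots> \<le> 1 - y + y\<^sup>2"
  proof -
    have "(1 - y + y\<^sup>2) * (1 + y) = 1 + y ^ 3" by (simp add: power2_eq_square power3_eq_cube algebra_simps)
    moreover have "y ^ 3 \<ge> 0" using y by simp
    ultimately show ?thesis using y by (simp add: divide_le_eq)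
  qed
  finally show ?thesis by (simp add: y_def)
qed

lemma ucont_local_window:
  assumes "\<And>w w'. (\<forall>i\<in>{0..<int n}. w i = w' i) \<Longrightarrow> F w = F w'" shows "ucont F"
  by (rule ucont_local[of n]) (rule assms, auto simp: agree_def)

text \<open>Divide by K and let it grow. In the application K counts windows and n is a fixed
  multiple of K, so this is where o(n) errors disappear.\<close>

lemma le_of_linear_bounds:
  fixes x y :: real
  assumes "\<And>e. e > 0 \<Longrightarrow> \<exists>C. \<forall>K>0. real K * x \<le> real K * y + e * real K + C"
  shows "x \<le> y"
proof (rule field_le_epsilon)
  fix e :: real assume e: "e > 0"
  then obtain C where C: "\<And>K. K > 0 \<Longrightarrow> real K * x \<le> real K * y + (e/2) * real K + C"
    using assms[of "e/2"] by auto
  obtain K where K: "real K > 2 * \<bar>C\<bar> / e" using reals_Archimedean2 by blast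
  moreover have "2 * \<bar>C\<bar> / e \<ge> 0" using e by simp
  ultimately have K0: "K > 0" by (metis le_less_trans of_nat_0_less_iff)
  have "C \<le> (e/2) * real K" using K e by (simp add: field_simps)
  then have "real K * x \<le> real K * (y + e)" using C[OF K0] by (simp add: algebra_simps)
  then show "x \<le> y + e" using K0 by simp
qed

locale equilibrium = ext_potential phi + invariant_measure mu
  for phi :: "(int \<Rightarrow> 'e::finite) \<Rightarrow> real" and mu :: "(int \<Rightarrow> 'e) measure" +
  assumes variational: "ks_entropy mu + integral\<^sup>L mu phi = top_pressure phi"
begin

lemma ucont_integrable:
  assumes "ucont f" shows "integrable mu f"
proof -
  obtain B where B: "\<And>w. \<bar>f w\<bar> \<le> B" using ucont_bounded[OF assms] by blast
  show ?thesis
    by (rule integrable_const_bound[of _ B]) (use B ucont_measurable[OF assms] in \<open>auto simp: measurable_mu\<close>)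
qed

text \<open>The variational equality enters the argument here, as a lower bound on the randomness of
  words of length n.\<close>

lemma block_entropy_lower:
  assumes "n > 0"
  shows "real n * (top_pressure phi - integral\<^sup>L mu phi) \<le> part_entropy mu (itin (\<lambda>w. w 0) n)"
proof -
  have "top_pressure phi - integral\<^sup>L mu phi = ks_entropy mu" using variational by simp
  then show ?thesis using ks_entropy_le[OF assms] assms by (simp add: field_simps)
qed

lemma integral_birkhoff: "integral\<^sup>L mu (birkhoff n phi) = real n * integral\<^sup>L mu phi"
proof -
  have "integral\<^sup>L mu (birkhoff n phi) = integral\<^sup>L mu (\<lambda>w. \<Sum>k<n. phi (shiftp (int k) w))"
    by (simp add: birkhoff_def[abs_def] funpow_shift)
  also have "\<dots> = (\<Sum>k<n. integral\<^sup>L mu (\<lambda>w. phi (shiftp (int k) w)))"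
    by (intro Bochner_Integration.integral_sum ucont_integrable ucont_shiftp ucont_phi)
  also have "\<dots> = (\<Sum>k<n. integral\<^sup>L mu phi)"
    by (intro sum.cong refl integral_shiftp) (simp add: measurable_mu ucont_measurable[OF ucont_phi])
  finally show ?thesis by simp
qed

lemma ucont_birkhoff: "ucont (birkhoff n phi)"
  unfolding birkhoff_def[abs_def] funpow_shift by (intro ucont_sum ucont_shiftp ucont_phi)

text \<open>The logarithm of the tilted kernel is S_n phi - n P + F - ln Z up to e n + C. In Gibbs'
  inequality the pressure and the mean of phi occur on both sides and cancel, leaving F against ln
  Z. The constant is independent of n and of F, so F may be chosen with n.\<close>

lemma integral_le_ln_partition:
  assumes e: "e > 0"
  shows "\<exists>C. \<forall>n F. n > 0 \<longrightarrow> (\<forall>w w'. (\<forall>i\<in>{0..<int n}. w i = w' i) \<longrightarrow> F w = F w')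
     \<longrightarrow> integral\<^sup>L mu F \<le> ln (spec_apply kernel {0..<int n} (\<lambda>w. exp (F w)) c) + e * real n + C"
proof -
  have e2: "e/2 > 0" using e by simp
  obtain C1 where C1: "\<And>n w. \<bar>ln (kernel {0..<int n} w w) - (birkhoff n phi w - real n * top_pressure phi)\<bar> \<le> (e/2) * real n + C1"
    using kernel_birkhoff_bound[OF e2] by blast
  obtain C2 where C2: "\<And>n w w'. (\<And>i. i \<in> {0..<int n} \<Longrightarrow> w i = w' i)
     \<Longrightarrow> \<bar>birkhoff n phi w - birkhoff n phi w'\<bar> \<le> (e/2) * real n + C2"
    using birkhoff_local_bound[OF ucont_phi e2] by blast
  have "integral\<^sup>L mu F \<le> ln (spec_apply kernel {0..<int n} (\<lambda>w. exp (F w)) c) + e * real n + (C1 + C2)"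
    if n: "n > 0" and F: "\<And>w w'. (\<forall>i\<in>{0..<int n}. w i = w' i) \<Longrightarrow> F w = F w'" for n F
  proof -
    let ?L = "{0..<int n}"
    define Z where "Z = spec_apply kernel ?L (\<lambda>w. exp (F w)) c"
    have Z: "Z > 0" unfolding Z_def by (rule spec_apply_pos) auto
    define al where "al = itin (\<lambda>w :: int \<Rightarrow> 'e. w 0) n"
    \<comment> \<open>A word is written into the block over the fixed boundary condition c. Since F
      depends on the block alone, replacing the outside of w by c leaves F unchanged and alters the
      Birkhoff sum by the boundary error \<open>C2\<close>.\<close>
    define wd where "wd = (\<lambda>ws :: 'e list. glue ?L (\<lambda>i. ws ! nat i) c)"
    define q where "q = (\<lambda>ws. kernel ?L (wd ws) c * exp (F (wd ws)) / Z)"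
    have am: "al \<in> measurable mu (count_space UNIV)"
      unfolding al_def
      by (rule itin_measurable) (auto simp: measurable_mu agree_def intro!: local_measurable[of 0])
    have fin: "finite (al ` space mu)"
      unfolding al_def using finite_range_itin[of "\<lambda>w :: int \<Rightarrow> 'e. w 0" n] by simp
    have wdal: "wd (al w) = glue ?L w c" for w
      by (rule ext) (simp add: wd_def al_def glue_def itin_nth nat_less_iff shiftp_def)
    have inj: "inj_on wd (al ` space mu)"
    proof (rule inj_onI)
      fix us vs assume "us \<in> al ` space mu" "vs \<in> al ` space mu" and eq: "wd us = wd vs"
      then have len: "length us = n" "length vs = n" by (auto simp: al_def)
      have "us ! i = vs ! i" if "i < n" for i
        using fun_cong[OF eq, of "int i"] that by (simp add: wd_def glue_def)
      then show "us = vs" using len by (simp add: nth_equalityI)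
    qed
    have qpos: "q ws > 0" for ws unfolding q_def using Z kernel_pos[of ?L] by simp
    have "(\<Sum>ws\<in>al ` space mu. q ws) = (\<Sum>x\<in>wd ` al ` space mu. kernel ?L x c * exp (F x) / Z)"
      unfolding q_def by (rule sum.reindex[OF inj, symmetric, unfolded o_def])
    also have "\<dots> \<le> (\<Sum>x\<in>conf ?L c. kernel ?L x c * exp (F x) / Z)"
      by (rule sum_mono2) (use Z kernel_pos[of ?L] in \<open>auto simp: finite_conf wd_def glue_in_conf less_imp_le\<close>)
    also have "\<dots> = 1" using Z by (simp add: sum_divide_distrib[symmetric] Z_def spec_apply_def)
    finally have sum: "(\<Sum>ws\<in>al ` space mu. q ws) \<le> 1" .
    have Fu: "ucont F" by (rule ucont_local_window[of n]) (rule F)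
    have "real n * (top_pressure phi - integral\<^sup>L mu phi) \<le> part_entropy mu al"
      unfolding al_def by (rule block_entropy_lower[OF n])
    also have "\<dots> \<le> - integral\<^sup>L mu (\<lambda>w. ln (q (al w)))"
      by (rule part_entropy_le_cross_entropy[OF am fin _ _ sum]) (use qpos in \<open>auto simp: less_imp_le\<close>)
    finally have 1: "integral\<^sup>L mu (\<lambda>w. ln (q (al w))) \<le> real n * integral\<^sup>L mu phi - real n * top_pressure phi"
      by (simp add: algebra_simps)
    define K where "K = real n * top_pressure phi + e * real n + (C1 + C2) + ln Z"
    have pt: "birkhoff n phi w + F w - K \<le> ln (q (al w))" for w
    proof -
      let ?x = "glue ?L w c"
      have "kernel ?L ?x c = kernel ?L ?x ?x" by (rule kernel_conf_self[OF glue_in_conf])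
      then have "ln (q (al w)) = ln (kernel ?L ?x ?x) + F ?x - ln Z"
        unfolding q_def wdal using Z kernel_pos[of ?L ?x ?x] by (simp add: ln_div ln_mult)
      moreover have "F ?x = F w" by (rule F) (simp add: glue_def)
      moreover have "\<bar>birkhoff n phi w - birkhoff n phi ?x\<bar> \<le> (e/2) * real n + C2"
        by (rule C2) (simp add: glue_def)
      moreover have "e * real n = 2 * ((e/2) * real n)" by simp
      ultimately show ?thesis using C1[of n ?x] unfolding K_def abs_le_iff by linarith
    qed
    have int: "integrable mu (\<lambda>w. birkhoff n phi w + F w)"
      by (intro ucont_integrable ucont_add ucont_birkhoff Fu)
    have "integral\<^sup>L mu (\<lambda>w. birkhoff n phi w + F w - K) \<le> integral\<^sup>L mu (\<lambda>w. ln (q (al w)))"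
      by (rule integral_mono) (use int pt integral_finite_valued(1)[OF am fin, of "\<lambda>y. ln (q y)"] in auto)
    also have "integral\<^sup>L mu (\<lambda>w. birkhoff n phi w + F w - K) = real n * integral\<^sup>L mu phi + integral\<^sup>L mu F - K"
      using int ucont_integrable[OF ucont_birkhoff] ucont_integrable[OF Fu] prob_space
      by (simp add: integral_birkhoff)
    finally show ?thesis using 1 by (simp add: K_def Z_def)
  qed
  then show ?thesis by blast
qed

text \<open>The k-th translate of g lives on the block of length 2 d + 1 centred at k (2 d + 1) + d,
  and these blocks tile the interval. Consistency inserts the kernel of the translated L inside the
  last block: it fixes the earlier factors and averages the last one to at most exp b for every
  outer configuration.\<close>

lemma spec_apply_exp_sparse_le:
  assumes L: "finite L" "L \<subseteq> {- int d..int d}"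
    and g: "\<And>w w'. agree d w w' \<Longrightarrow> g w = g w'"
    and b: "\<And>w. spec_apply kernel L (\<lambda>w. exp (t * g w)) w \<le> exp b"
    and jK: "j \<le> K"
  shows "spec_apply kernel {0..<int (K * (2 * d + 1))} (\<lambda>w. exp (t * (\<Sum>k<j. g (shiftp (int (k * (2 * d + 1) + d)) w)))) c
     \<le> exp (real j * b)"
  using jK
proof (induction j)
  case 0
  show ?case by (simp add: spec_apply_const)
next
  case (Suc j)
  let ?L = "{0..<int (K * (2 * d + 1))}"
  let ?F = "\<lambda>w. \<Sum>k<j. g (shiftp (int (k * (2 * d + 1) + d)) w)"
  define s where "s = int (j * (2 * d + 1) + d)"
  let ?D = "(\<lambda>i. i + s) ` L"
  have Dsub: "?D \<subseteq> {int (j * (2 * d + 1))..<int ((j + 1) * (2 * d + 1))}"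
  proof (rule subsetI)
    fix i assume "i \<in> ?D"
    then obtain l where "l \<in> L" "i = l + s" by auto
    moreover from this L(2) have "- int d \<le> l" "l \<le> int d" by auto
    ultimately show "i \<in> {int (j * (2 * d + 1))..<int ((j + 1) * (2 * d + 1))}"
      by (simp add: s_def algebra_simps)
  qed
  have "(j + 1) * (2 * d + 1) \<le> K * (2 * d + 1)" using Suc.prems by (intro mult_right_mono) auto
  then have jK: "int ((j + 1) * (2 * d + 1)) \<le> int (K * (2 * d + 1))" by (simp only: of_nat_le_iff)
  have DL: "?D \<subseteq> ?L"
  proof (rule subset_trans[OF Dsub], rule subsetI)
    fix i assume "i \<in> {int (j * (2 * d + 1))..<int ((j + 1) * (2 * d + 1))}"
    then have "int (j * (2 * d + 1)) \<le> i" "i < int ((j + 1) * (2 * d + 1))"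
      by (simp_all only: atLeastLessThan_iff)
    moreover have "0 \<le> int (j * (2 * d + 1))" by (rule of_nat_0_le_iff)
    ultimately show "i \<in> ?L" using jK unfolding atLeastLessThan_iff by linarith
  qed
  have fD: "finite ?D" using L by simp
  \<comment> \<open>The translates with k < j read earlier blocks, which resampling inside the j-th
    block does not touch.\<close>
  have Fc: "?F eta = ?F w" if eta: "eta \<in> conf ?D w" for eta w
  proof (rule sum.cong[OF refl], rule g, unfold agree_def shiftp_def, intro allI impI)
    fix k i assume k: "k \<in> {..<j}" and i: "\<bar>i\<bar> \<le> int d"
    have "(k + 1) * (2 * d + 1) \<le> j * (2 * d + 1)" using k by (intro mult_right_mono) auto
    then have "int ((k + 1) * (2 * d + 1)) \<le> int (j * (2 * d + 1))" by (simp only: of_nat_le_iff)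
    moreover have "i + int (k * (2 * d + 1) + d) < int ((k + 1) * (2 * d + 1))" using i by (simp add: algebra_simps)
    ultimately have "i + int (k * (2 * d + 1) + d) \<notin> ?D" using Dsub by (auto dest!: subsetD)
    then show "eta (i + int (k * (2 * d + 1) + d)) = w (i + int (k * (2 * d + 1) + d))"
      using eta by (simp add: conf_def)
  qed
  have split: "exp (t * (\<Sum>k<Suc j. g (shiftp (int (k * (2 * d + 1) + d)) w))) = exp (t * ?F w) * exp (t * g (shiftp s w))" for w
    by (simp add: s_def exp_add distrib_left)
  have inner: "spec_apply kernel ?D (\<lambda>w. exp (t * ?F w) * exp (t * g (shiftp s w))) eta \<le> exp b * exp (t * ?F eta)" for eta
  proof -
    have "spec_apply kernel ?D (\<lambda>w. exp (t * ?F w) * exp (t * g (shiftp s w))) eta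
        = (\<Sum>x\<in>conf ?D eta. exp (t * ?F eta) * (kernel ?D x eta * exp (t * g (shiftp s x))))"
      unfolding spec_apply_def
    proof (rule sum.cong[OF refl])
      fix x assume "x \<in> conf ?D eta"
      from Fc[OF this] show "kernel ?D x eta * (exp (t * ?F x) * exp (t * g (shiftp s x)))
          = exp (t * ?F eta) * (kernel ?D x eta * exp (t * g (shiftp s x)))"
        by (simp only: mult.left_commute)
    qed
    also have "\<dots> = exp (t * ?F eta) * spec_apply kernel ?D (\<lambda>w. exp (t * g (shiftp s w))) eta"
      unfolding spec_apply_def by (rule sum_distrib_left[symmetric])
    also have "spec_apply kernel ?D (\<lambda>w. exp (t * g (shiftp s w))) eta = spec_apply kernel L (\<lambda>w. exp (t * g w)) (shiftp s eta)"
      by (rule spec_apply_shiftp[OF L(1)])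
    also have "exp (t * ?F eta) * \<dots> \<le> exp (t * ?F eta) * exp b" by (intro mult_left_mono b) auto
    finally show ?thesis by (simp add: mult.commute)
  qed
  have "spec_apply kernel ?L (\<lambda>w. exp (t * (\<Sum>k<Suc j. g (shiftp (int (k * (2 * d + 1) + d)) w)))) c
      = (\<Sum>eta\<in>conf ?L c. kernel ?L eta c * spec_apply kernel ?D (\<lambda>w. exp (t * ?F w) * exp (t * g (shiftp s w))) eta)"
    unfolding split by (rule kernel_consistent[OF _ DL, symmetric]) simp
  also have "\<dots> \<le> (\<Sum>eta\<in>conf ?L c. kernel ?L eta c * (exp b * exp (t * ?F eta)))"
    by (intro sum_mono mult_left_mono inner less_imp_le[OF kernel_pos]) simp
  also have "\<dots> = exp b * spec_apply kernel ?L (\<lambda>w. exp (t * ?F w)) c"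
    by (simp add: spec_apply_def sum_distrib_left algebra_simps)
  also have "\<dots> \<le> exp b * exp (real j * b)" using Suc by (intro mult_left_mono) auto
  also have "\<dots> = exp (real (Suc j) * b)" by (simp add: exp_add[symmetric] algebra_simps)
  finally show ?case .
qed

text \<open>With |t g| <= 1, the bound exp x <= 1 + x + x^2 gives cost b = t e' + t^2 B^2 per
  window, hence t mu(g) <= b for each small t. Allowing e' in place of 0 makes room for local
  approximations, whose conditional expectation is merely small.\<close>

lemma integral_local_le:
  assumes L: "finite L" "L \<subseteq> {- int d..int d}"
    and g: "\<And>w w'. agree d w w' \<Longrightarrow> g w = g w'"
    and s: "\<And>w. spec_apply kernel L g w \<le> e'"
  shows "integral\<^sup>L mu g \<le> e'"
proof -
  have gu: "ucont g" by (rule ucont_local[of d]) (rule g)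
  obtain B where B: "B \<ge> 0" "\<And>w. \<bar>g w\<bar> \<le> B" using ucont_bounded[OF gu] by blast
  define m where "m = 2 * d + 1"
  have m: "real m > 0" by (simp add: m_def)
  have main: "t * integral\<^sup>L mu g \<le> t * e' + t\<^sup>2 * B\<^sup>2" if t: "t > 0" "t * B \<le> 1" for t
  proof -
    define b where "b = t * e' + t\<^sup>2 * B\<^sup>2"
    have b: "spec_apply kernel L (\<lambda>w. exp (t * g w)) w \<le> exp b" for w
    proof -
      have "exp (t * g v) \<le> (1 + t\<^sup>2 * B\<^sup>2) + t * g v" for v
      proof -
        have tg: "\<bar>t * g v\<bar> \<le> t * B" using t B by (simp add: abs_mult)
        then have "\<bar>t * g v\<bar> \<le> 1" using t(2) by linarith
        then have "exp (t * g v) \<le> 1 + t * g v + (t * g v)\<^sup>2" by (rule exp_le_quadratic)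
        moreover have "(t * g v)\<^sup>2 \<le> (t * B)\<^sup>2" using tg by (rule abs_le_square_iff[THEN iffD1, OF order.trans]) simp
        ultimately show ?thesis by (simp add: power_mult_distrib)
      qed
      then have "spec_apply kernel L (\<lambda>w. exp (t * g w)) w \<le> spec_apply kernel L (\<lambda>w. (1 + t\<^sup>2 * B\<^sup>2) + t * g w) w"
        by (intro spec_apply_mono L)
      also have "\<dots> = 1 + t\<^sup>2 * B\<^sup>2 + t * spec_apply kernel L g w"
        using L(1) by (simp add: spec_apply_add spec_apply_cmult spec_apply_const)
      also have "\<dots> \<le> 1 + b" unfolding b_def using s[of w] t by simp
      also have "\<dots> \<le> exp b" by (rule exp_ge_add_one_self)
      finally show ?thesis .
    qed
    show ?thesis unfolding b_def[symmetric]
    proof (rule le_of_linear_bounds)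
      fix e :: real assume e: "e > 0"
      \<comment> \<open>At length n = K m the rate e / m produces an error of e per window.\<close>
      have "e / real m > 0" using e m by simp
      then obtain C where C: "\<And>n F. n > 0 \<Longrightarrow> (\<And>w w'. (\<forall>i\<in>{0..<int n}. w i = w' i) \<Longrightarrow> F w = F w')
        \<Longrightarrow> integral\<^sup>L mu F \<le> ln (spec_apply kernel {0..<int n} (\<lambda>w. exp (F w)) undefined) + e / real m * real n + C"
        using integral_le_ln_partition[of "e / real m" undefined] by blast
      have "real K * (t * integral\<^sup>L mu g) \<le> real K * b + e * real K + C" if K: "K > 0" for K
      proof -
        define F where "F = (\<lambda>w. t * (\<Sum>k<K. g (shiftp (int (k * m + d)) w)))"
        have Floc: "F w = F w'" if w: "\<forall>i\<in>{0..<int (K * m)}. w i = w' i" for w w'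
          unfolding F_def
        proof (rule arg_cong[where f = "\<lambda>x. t * x"], rule sum.cong[OF refl], rule g, unfold agree_def shiftp_def, intro allI impI)
          fix k i assume k: "k \<in> {..<K}" and i: "\<bar>i\<bar> \<le> int d"
          have "(k + 1) * m \<le> K * m" using k by (intro mult_right_mono) auto
          then have "int ((k + 1) * m) \<le> int (K * m)" by (simp only: of_nat_le_iff)
          moreover have "i + int (k * m + d) < int ((k + 1) * m)" using i by (simp add: m_def algebra_simps)
          moreover have "0 \<le> int (k * m)" by (rule of_nat_0_le_iff)
          then have "i + int (k * m + d) \<ge> 0" using i unfolding of_nat_add by linarith
          ultimately show "w (i + int (k * m + d)) = w' (i + int (k * m + d))" using w by auto
        qed
        have "integral\<^sup>L mu F = t * (\<Sum>k<K. integral\<^sup>L mu (\<lambda>w. g (shiftp (int (k * m + d)) w)))"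
          unfolding F_def
          by (subst Bochner_Integration.integral_mult_right_zero, subst Bochner_Integration.integral_sum)
             (auto intro!: ucont_integrable ucont_shiftp gu)
        also have "\<dots> = t * (\<Sum>k<K. integral\<^sup>L mu g)"
          by (intro arg_cong[where f = "\<lambda>x. t * x"] sum.cong refl integral_shiftp)
             (simp add: measurable_mu ucont_measurable[OF gu])
        finally have IF: "integral\<^sup>L mu F = real K * (t * integral\<^sup>L mu g)" by simp
        have n: "K * m > 0" using K by (simp add: m_def)
        have Z0: "spec_apply kernel {0..<int (K * m)} (\<lambda>w. exp (F w)) undefined > 0" by (rule spec_apply_pos) auto
        have "spec_apply kernel {0..<int (K * m)} (\<lambda>w. exp (F w)) undefined \<le> exp (real K * b)"
          unfolding F_def m_def by (rule spec_apply_exp_sparse_le[OF L g b order.refl])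
        then have "ln (spec_apply kernel {0..<int (K * m)} (\<lambda>w. exp (F w)) undefined) \<le> real K * b"
          using Z0 by (metis ln_exp ln_mono exp_gt_zero)
        moreover have "e / real m * real (K * m) = e * real K" using m by simp
        moreover have "integral\<^sup>L mu F \<le> ln (spec_apply kernel {0..<int (K * m)} (\<lambda>w. exp (F w)) undefined)
            + e / real m * real (K * m) + C"
          by (rule C[OF n]) (rule Floc)
        ultimately show ?thesis using IF by linarith
      qed
      then show "\<exists>C. \<forall>K>0. real K * (t * integral\<^sup>L mu g) \<le> real K * b + e * real K + C" by blast
    qed
  qed
  show ?thesis
  proof (rule field_le_epsilon)
    fix e :: real assume e: "e > 0"
    \<comment> \<open>The first entry gives t B <= 1, as the quadratic bound requires, the second t
      B^2 <= e; the added 1 in each denominator covers B = 0.\<close>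
    define t where "t = min (1 / (B + 1)) (e / (B\<^sup>2 + 1))"
    have B2: "B\<^sup>2 + 1 > 0" by (simp add: add_nonneg_pos)
    have t: "t > 0" using e B B2 by (simp add: t_def)
    have "t * B \<le> 1 / (B + 1) * B" using B by (intro mult_right_mono) (auto simp: t_def)
    also have "\<dots> \<le> 1" using B by (simp add: field_simps)
    finally have tB: "t * B \<le> 1" .
    have "t * B\<^sup>2 \<le> e / (B\<^sup>2 + 1) * B\<^sup>2" by (intro mult_right_mono) (auto simp: t_def)
    also have "\<dots> \<le> e" using e B2 by (simp add: field_simps)
    finally have te: "t * B\<^sup>2 \<le> e" .
    have "t * integral\<^sup>L mu g \<le> t * (e' + t * B\<^sup>2)" using main[OF t tB] by (simp add: power2_eq_square algebra_simps)
    then have "integral\<^sup>L mu g \<le> e' + t * B\<^sup>2" using t by simp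
    then show "integral\<^sup>L mu g \<le> e' + e" using te by linarith
  qed
qed

text \<open>A local g' within e/2 of g has conditional expectation at most e/2 and an integral
  within e/2 of that of g, so the total loss is e.\<close>

lemma integral_nonpos:
  assumes L: "finite L" and g: "ucont g" and s: "\<And>w. spec_apply kernel L g w = 0"
  shows "integral\<^sup>L mu g \<le> 0"
proof (rule field_le_epsilon)
  fix e :: real assume e: "e > 0"
  obtain N where N: "\<And>w w'. agree N w w' \<Longrightarrow> \<bar>g w - g w'\<bar> \<le> e/2" using ucontD[OF g half_gt_zero[OF e]] by blast
  define Q where "Q = (\<Sum>i\<in>L. nat \<bar>i\<bar>)"
  define d where "d = N + Q"
  have Ld: "L \<subseteq> {- int d..int d}"
  proof
    fix i assume "i \<in> L"
    then have "nat \<bar>i\<bar> \<le> Q" unfolding Q_def using L by (intro member_le_sum) auto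
    then show "i \<in> {- int d..int d}" by (auto simp: d_def)
  qed
  \<comment> \<open>Sites beyond d are filled from one arbitrary fixed configuration. The radius d =
    N + Q both keeps g' close to g and places L inside the window.\<close>
  define g' where "g' = (\<lambda>w. g (glue {- int d..int d} w undefined))"
  have g': "g' w = g' w'" if "agree d w w'" for w w'
  proof -
    have "glue {- int d..int d} w undefined = glue {- int d..int d} w' undefined"
      using that by (auto simp: glue_def agree_def abs_le_iff)
    then show ?thesis by (simp add: g'_def)
  qed
  have close: "\<bar>g w - g' w\<bar> \<le> e/2" for w
    unfolding g'_def by (rule N) (auto simp: agree_def glue_def d_def)
  have sp: "spec_apply kernel L g' w \<le> e/2" for w
  proof -
    have "g' v \<le> e/2 + g v" for v using close[of v] by linarith
    then have "spec_apply kernel L g' w \<le> spec_apply kernel L (\<lambda>v. e/2 + g v) w" by (intro spec_apply_mono L)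
    then show ?thesis using L s by (simp add: spec_apply_add spec_apply_const)
  qed
  have 1: "integral\<^sup>L mu g' \<le> e/2"
    by (rule integral_local_le[OF L Ld]) (rule g', assumption, rule sp)
  have g'u: "ucont g'" by (rule ucont_local[of d]) (rule g')
  have "integral\<^sup>L mu g \<le> integral\<^sup>L mu (\<lambda>w. e/2 + g' w)"
  proof (rule integral_mono)
    show "g w \<le> e/2 + g' w" for w using close[of w] by linarith
  qed (intro ucont_integrable ucont_add ucont_const g g'u)+
  also have "\<dots> = e/2 + integral\<^sup>L mu g'" using ucont_integrable[OF g'u] prob_space by simp
  finally show "integral\<^sup>L mu g \<le> 0 + e" using 1 by simp
qed

text \<open>Consistency with D = L makes the kernel idempotent, so f minus its kernel average is
  annihilated by the kernel. Using f and - f turns the inequality for its integral into an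
  equality.\<close>

lemma DLR:
  assumes L: "finite L" and f: "ucont f"
  shows "integral\<^sup>L mu (spec_apply kernel L f) = integral\<^sup>L mu f"
proof -
  have le: "integral\<^sup>L mu f \<le> integral\<^sup>L mu (spec_apply kernel L f)" if f: "ucont f" for f
  proof -
    define g where "g = (\<lambda>w. f w + (-1) * spec_apply kernel L f w)"
    have g: "ucont g" unfolding g_def by (intro ucont_add ucont_mult ucont_const ucont_spec_apply L f)
    have "spec_apply kernel L g w = 0" for w
      unfolding g_def spec_apply_add spec_apply_cmult
      using kernel_consistent[OF L order.refl, of w f] by (simp add: spec_apply_def[of _ _ "spec_apply _ _ _"])
    then have "integral\<^sup>L mu g \<le> 0" by (rule integral_nonpos[OF L g])
    moreover have "integral\<^sup>L mu g = integral\<^sup>L mu f - integral\<^sup>L mu (spec_apply kernel L f)"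
      unfolding g_def using ucont_integrable[OF f] ucont_integrable[OF ucont_spec_apply[OF L f]] by simp
    ultimately show ?thesis by simp
  qed
  have "spec_apply kernel L (\<lambda>w. - f w) = (\<lambda>w. - spec_apply kernel L f w)"
    by (rule ext) (simp add: spec_apply_def sum_negf)
  then show ?thesis using le[OF f] le[OF ucont_minus[OF f]] by simp
qed

section \<open>Cylinder measures\<close>

text \<open>The DLR equation for the indicator of the cylinder, which is continuous because the
  cylinder is clopen. For each outer configuration v, the pattern of w is the one filling of the
  block that lies in the cylinder.\<close>

lemma measure_cyl:
  "measure mu (cyl n w) = integral\<^sup>L mu (\<lambda>v. kernel {0..<int n} (glue {0..<int n} w v) (glue {0..<int n} w v))"
proof -
  let ?L = "{0..<int n}"
  have cyl: "v \<in> cyl n w \<longleftrightarrow> (\<forall>i\<in>?L. v i = w i)" for v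
  proof
    assume v: "v \<in> cyl n w"
    show "\<forall>i\<in>?L. v i = w i"
    proof
      fix i assume "i \<in> ?L"
      then obtain k where "i = int k" "k < n" by (metis atLeastLessThan_iff of_nat_less_iff zero_le_imp_eq_int)
      then show "v i = w i" using v by (simp add: cyl_def)
    qed
  next
    assume "\<forall>i\<in>?L. v i = w i"
    then show "v \<in> cyl n w" by (simp add: cyl_def)
  qed
  have u: "ucont (indicat_real (cyl n w))"
  proof (rule ucont_local_window[of n])
    fix v v' :: "int \<Rightarrow> 'e" assume "\<forall>i\<in>?L. v i = v' i"
    then have "v \<in> cyl n w \<longleftrightarrow> v' \<in> cyl n w" unfolding cyl by simp
    then show "indicat_real (cyl n w) v = indicat_real (cyl n w) v'" by (simp add: indicator_def)
  qed
  have sp: "spec_apply kernel ?L (indicat_real (cyl n w)) v = kernel ?L (glue ?L w v) (glue ?L w v)" for v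
  proof -
    have only: "eta \<in> cyl n w \<longleftrightarrow> eta = glue ?L w v" if "eta \<in> conf ?L v" for eta
    proof
      assume e: "eta \<in> cyl n w"
      show "eta = glue ?L w v"
      proof (rule ext)
        fix i show "eta i = glue ?L w v i"
          using e[unfolded cyl] that unfolding conf_def glue_def by (simp del: atLeastLessThan_iff)
      qed
    qed (simp add: cyl glue_def)
    have "spec_apply kernel ?L (indicat_real (cyl n w)) v
        = (\<Sum>eta\<in>conf ?L v. if eta = glue ?L w v then kernel ?L eta v else 0)"
      unfolding spec_apply_def by (rule sum.cong[OF refl]) (simp add: indicator_def only)
    also have "\<dots> = kernel ?L (glue ?L w v) v"
      by (subst sum.delta) (auto simp: finite_conf glue_in_conf)
    finally show ?thesis by (simp add: kernel_conf_self[OF glue_in_conf])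
  qed
  have "cyl n w \<in> sets mu"
  proof -
    have "v' \<in> cyl n w" if v: "agree n v v'" "v \<in> cyl n w" for v v'
      unfolding cyl
    proof
      fix i assume i: "i \<in> ?L"
      then have "v i = w i" using v(2) unfolding cyl by blast
      moreover have "v i = v' i" using v(1) i unfolding agree_def by simp
      ultimately show "v' i = w i" by simp
    qed
    then show ?thesis unfolding sets_mu by (rule local_set_sets)
  qed
  then show ?thesis using DLR[OF _ u, of ?L] unfolding ext[OF sp] by simp
qed

text \<open>The kernel estimate is uniform in the boundary condition, so it survives integration
  over v. The resulting exponential lower bound also gives positivity.\<close>

lemma ln_measure_cyl_bound:
  assumes e: "e > 0"
  shows "\<exists>C. \<forall>n w. measure mu (cyl n w) > 0 \<and>
     \<bar>ln (measure mu (cyl n w)) - (birkhoff n phi w - real n * top_pressure phi)\<bar> \<le> e * real n + C"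
proof -
  have e2: "e/2 > 0" using e by simp
  obtain C1 where C1: "\<And>n w. \<bar>ln (kernel {0..<int n} w w) - (birkhoff n phi w - real n * top_pressure phi)\<bar> \<le> (e/2) * real n + C1"
    using kernel_birkhoff_bound[OF e2] by blast
  obtain C2 where C2: "\<And>n w w'. (\<And>i. i \<in> {0..<int n} \<Longrightarrow> w i = w' i)
     \<Longrightarrow> \<bar>birkhoff n phi w - birkhoff n phi w'\<bar> \<le> (e/2) * real n + C2"
    using birkhoff_local_bound[OF ucont_phi e2] by blast
  have "measure mu (cyl n w) > 0 \<and>
     \<bar>ln (measure mu (cyl n w)) - (birkhoff n phi w - real n * top_pressure phi)\<bar> \<le> e * real n + (C1 + C2)" for n w
  proof -
    let ?L = "{0..<int n}"
    let ?k = "\<lambda>v. kernel ?L (glue ?L w v) (glue ?L w v)"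
    define X where "X = birkhoff n phi w - real n * top_pressure phi"
    define D where "D = e * real n + (C1 + C2)"
    have "\<bar>ln (?k v) - X\<bar> \<le> D" for v
    proof -
      have "\<bar>birkhoff n phi w - birkhoff n phi (glue ?L w v)\<bar> \<le> (e/2) * real n + C2"
        by (rule C2) (simp add: glue_def)
      moreover have "e * real n = 2 * ((e/2) * real n)" by simp
      ultimately show ?thesis using C1[of n "glue ?L w v"] unfolding X_def D_def abs_le_iff by linarith
    qed
    then have "X - D \<le> ln (?k v)" "ln (?k v) \<le> X + D" for v by (simp_all add: abs_le_iff algebra_simps)
    then have b: "exp (X - D) \<le> ?k v" "?k v \<le> exp (X + D)" for v
      using kernel_pos[of ?L] by (metis exp_le_cancel_iff exp_ln finite_atLeastLessThan_int)+
    have int: "integrable mu ?k" by (intro ucont_integrable ucont_glue[of "\<lambda>v. kernel ?L v v"] ucont_kernel) simp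
    have "integral\<^sup>L mu (\<lambda>_. exp (X - D)) \<le> integral\<^sup>L mu ?k" by (rule integral_mono) (use int b in auto)
    then have l: "exp (X - D) \<le> measure mu (cyl n w)" using prob_space by (simp add: measure_cyl)
    have "integral\<^sup>L mu ?k \<le> integral\<^sup>L mu (\<lambda>_. exp (X + D))" by (rule integral_mono) (use int b in auto)
    then have r: "measure mu (cyl n w) \<le> exp (X + D)" using prob_space by (simp add: measure_cyl)
    have pos: "measure mu (cyl n w) > 0" using l by (meson exp_gt_zero less_le_trans)
    have "X - D \<le> ln (measure mu (cyl n w))" using l pos by (simp add: ln_ge_iff)
    moreover have "ln (measure mu (cyl n w)) \<le> X + D" using r pos by (metis ln_exp ln_mono exp_gt_zero)
    ultimately show ?thesis using pos unfolding X_def[symmetric] D_def[symmetric] by (simp add: abs_le_iff algebra_simps)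
  qed
  then show ?thesis by blast
qed

text \<open>The constant of index n is exp (S n), with \<open>S n\<close> the supremum over w of the
  logarithmic error. It is finite by the bound at e = 1, and the bounds for all e give
  \<open>S n\<close> = o(n); P is the topological pressure.\<close>

lemma weak_bowen_gibbs_equilibrium: "weak_bowen_gibbs phi mu"
proof -
  define Y where "Y = (\<lambda>n w. \<bar>ln (measure mu (cyl n w)) - (birkhoff n phi w - real n * top_pressure phi)\<bar>)"
  define S where "S = (\<lambda>n. SUP w. Y n w)"
  have Ybound: "\<exists>C. \<forall>n w. Y n w \<le> e * real n + C" if "e > 0" for e
    using ln_measure_cyl_bound[OF that] unfolding Y_def by blast
  have bdd: "bdd_above (range (Y n))" for n
  proof -
    obtain C where "\<And>n w. Y n w \<le> 1 * real n + C" using Ybound[OF zero_less_one] by blast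
    then show ?thesis by (rule bdd_aboveI2)
  qed
  have YS: "Y n w \<le> S n" for n w unfolding S_def by (rule cSUP_upper[OF _ bdd]) simp
  have S0: "0 \<le> S n" for n using YS[of n undefined] abs_ge_zero unfolding Y_def by (rule order.trans[rotated])
  have pos: "measure mu (cyl n w) > 0" for n w using ln_measure_cyl_bound[OF zero_less_one] by blast
  have lim: "(\<lambda>n. S n / real n) \<longlonglongrightarrow> 0"
  proof (rule LIMSEQ_I)
    fix e :: real assume e: "e > 0"
    obtain C where C: "\<And>n w. Y n w \<le> (e/2) * real n + C" using Ybound[OF half_gt_zero[OF e]] by blast
    obtain N where N: "real N > 2 * \<bar>C\<bar> / e" using reals_Archimedean2 by blast
    have "norm (S n / real n - 0) < e" if n: "n \<ge> Suc N" for n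
    proof -
      have n0: "real n > 0" using n by simp
      have "S n \<le> (e/2) * real n + C" unfolding S_def by (rule cSUP_least[OF UNIV_not_empty C])
      moreover have "2 * \<bar>C\<bar> / e < real n" using N n by linarith
      then have "\<bar>C\<bar> < (e/2) * real n" using e by (simp add: field_simps)
      ultimately have "S n < (e/2) * real n + (e/2) * real n" by linarith
      then have "S n < e * real n" by simp
      then show ?thesis using n0 S0[of n] by (simp add: divide_less_eq)
    qed
    then show "\<exists>no. \<forall>n\<ge>no. norm (S n / real n - 0) < e" by blast
  qed
  have bounds: "1 / exp (S n) \<le> measure mu (cyl n w) / exp (birkhoff n phi w - real n * top_pressure phi)
      \<and> measure mu (cyl n w) / exp (birkhoff n phi w - real n * top_pressure phi) \<le> exp (S n)" for n w
  proof -
    define x where "x = ln (measure mu (cyl n w)) - (birkhoff n phi w - real n * top_pressure phi)"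
    have "measure mu (cyl n w) / exp (birkhoff n phi w - real n * top_pressure phi) = exp x"
      unfolding x_def using pos[of n w] by (simp add: exp_diff)
    moreover have "\<bar>x\<bar> \<le> S n" using YS[of n w] by (simp add: Y_def x_def)
    moreover have "1 / exp (S n) = exp (- S n)" by (simp add: exp_minus inverse_eq_divide)
    ultimately show ?thesis by (simp add: abs_le_iff)
  qed
  show ?thesis unfolding weak_bowen_gibbs_def
    by (intro exI[of _ "top_pressure phi"] exI[of _ "\<lambda>n. exp (S n)"]) (use lim bounds in auto)
qed

end

theorem theoremA:
  fixes phi :: "(int \<Rightarrow> 'e::finite) \<Rightarrow> real"
    and mu :: "(int \<Rightarrow> 'e) measure"
  assumes "continuous_map Omega_top euclideanreal phi"
    and "extensible phi"
    and "equilibrium_state phi mu"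
  shows "(\<exists>gamma. gibbsian_specification gamma \<and> gibbs_measure gamma mu)
         \<and> weak_bowen_gibbs phi mu"
  proof -
  interpret equilibrium phi mu
    using assms by unfold_locales (auto simp: equilibrium_state_def continuous_map_iff_ucont)
  have "gibbs_measure kernel mu"
    by (simp add: gibbs_measure_def continuous_map_iff_ucont DLR)
  then show ?thesis using kernel_gibbsian weak_bowen_gibbs_equilibrium by blast
qed

end
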